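(* Let $(\mathfrak{h},[\cdot,\cdot])$ be a finite-dimensional real left Leibniz algebra, with center $Z(\mathfrak{h})=\{a:[a,\mathfrak{h}]=[\mathfrak{h},a]=0\}$ and derived subspace $[\mathfrak{h},\mathfrak{h}]$. (1) If $\mathfrak{h}$ is a Lie algebra (i.e. its bracket is skew-symmetric), $[\mathfrak{h},\mathfrak{h}]+Z(\mathfrak{h})\neq\mathfrak{h}$ and $Z(\mathfrak{h})\neq\{0\}$, then $\mathfrak{h}$ is not rigid. (2) If $[\mathfrak{h},\mathfrak{h}]+Z(\mathfrak{h})\neq\mathfrak{h}$ and $Z(\mathfrak{h})$ is not contained in $[\mathfrak{h},\mathfrak{h}]$, then $\mathfrak{h}$ is not rigid.
   Context: A left Leibniz algebra: bilinear bracket with $[u,[v,w]]=[[u,v],w]+[v,[u,w]]$; $\mathrm{ad}_x(y)=[x,y]$. A linear Lie rack structure on a finite-dimensional real vector space $V$ is a map $\rhd:V\times V\to V$, smooth, with each $\mathrm{L}_x:y\mapsto x\rhd y$ a linear bijection, $x\rhd(y\rhd z)=(x\rhd y)\rhd(x\rhd z)$, $x\rhd 0=0$ and $\mathrm{L}_0=\mathrm{Id}$. It is analytic if $x\rhd y=y+\sum_{n\ge1}A_{n,1}(x,\ldots,x,y)$ (convergent) with $A_{n,1}$ $(n+1)$-multilinear and symmetric in the first $n$ arguments. Its associated bracket is $[u,v]_{\rhd}=\frac{d}{dt}\big|_{t=0}\mathrm{L}_{tu}(v)$. A left Leibniz algebra $(\mathfrak{h},[\cdot,\cdot])$ is called rigid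 if every analytic linear Lie rack structure $\rhd$ on $\mathfrak{h}$ with $[\cdot,\cdot]_{\rhd}=[\cdot,\cdot]$ is of the form $x\rhd y=\exp\big(F(P(x,\ldots,x))\mathrm{ad}_x\big)(y)$, where $F:\mathbb{R}\to\mathbb{R}$ is analytic with $F(0)=1$ and $P$ is a real symmetric multilinear $p$-form on $\mathfrak{h}$ satisfying $\sum_{i=1}^pP(x_1,\ldots,[y,x_i],\ldots,x_p)=0$ for all $y,x_1,\ldots,x_p$. *)

theory Defs
  imports "HOL-Analysis.Analysis"
begin

definition bilinear_bracket :: "('a::real_vector \<Rightarrow> 'a \<Rightarrow> 'a) \<Rightarrow> bool" where
  "bilinear_bracket br \<longleftrightarrow> (\<forall>x. linear (br x)) \<and> (\<forall>y. linear (\<lambda>x. br x y))"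

definition left_leibniz_algebra :: "('a::real_vector \<Rightarrow> 'a \<Rightarrow> 'a) \<Rightarrow> bool" where
  "left_leibniz_algebra br \<longleftrightarrow> bilinear_bracket br \<and>
     (\<forall>u v w. br u (br v w) = br (br u v) w + br v (br u w))"

definition is_lie_bracket :: "('a::real_vector \<Rightarrow> 'a \<Rightarrow> 'a) \<Rightarrow> bool" where
  "is_lie_bracket br \<longleftrightarrow> (\<forall>x y. br x y = - br y x)"

definition lcenter :: "('a::real_vector \<Rightarrow> 'a \<Rightarrow> 'a) \<Rightarrow> 'a set" where
  "lcenter br = {a. \<forall>x. br a x = 0 \<and> br x a = 0}"

definition derived :: "('a::real_vector \<Rightarrow> 'a \<Rightarrow> 'a) \<Rightarrow> 'a set" where
  "derived br = span {br x y | x y. True}"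

definition multilinear :: "nat \<Rightarrow> ('a::real_vector list \<Rightarrow> 'b::real_vector) \<Rightarrow> bool" where
  "multilinear p F \<longleftrightarrow> (\<forall>xs i. length xs = p \<and> i < p \<longrightarrow> linear (\<lambda>v. F (xs[i := v])))"

definition symmetric_args :: "nat \<Rightarrow> ('a list \<Rightarrow> 'b) \<Rightarrow> bool" where
  "symmetric_args p F \<longleftrightarrow> (\<forall>xs ys. length xs = p \<and> mset xs = mset ys \<longrightarrow> F xs = F ys)"

text \<open>D k x [v1,...,vk] is the k-th Frechet derivative of f at x applied to v1..vk;
  all of them exist everywhere.\<close>
definition smooth_map :: "('c::real_normed_vector \<Rightarrow> 'b::real_normed_vector) \<Rightarrow> bool" where
  "smooth_map f \<longleftrightarrow> (\<exists>D :: nat \<Rightarrow> 'c \<Rightarrow> 'c list \<Rightarrow> 'b.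
      (\<forall>x. D 0 x [] = f x) \<and>
      (\<forall>k vs x. length vs = k \<longrightarrow>
          ((\<lambda>y. D k y vs) has_derivative (\<lambda>v. D (Suc k) x (v # vs))) (at x)))"

definition linear_lie_rack :: "('a::euclidean_space \<Rightarrow> 'a \<Rightarrow> 'a) \<Rightarrow> bool" where
  "linear_lie_rack rk \<longleftrightarrow>
     smooth_map (\<lambda>(x, y). rk x y) \<and>
     (\<forall>x. linear (rk x) \<and> bij (rk x)) \<and>
     (\<forall>x y z. rk x (rk y z) = rk (rk x y) (rk x z)) \<and>
     (\<forall>x. rk x 0 = 0) \<and>
     rk 0 = id"

text \<open>Analytic: x |> y = y + sum_{n>=1} A_n(x,...,x,y), A_n being (n+1)-multilinear and
  symmetric in its first n arguments (A n xs y with length xs = n).\<close>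
definition analytic_rack :: "('a::euclidean_space \<Rightarrow> 'a \<Rightarrow> 'a) \<Rightarrow> bool" where
  "analytic_rack rk \<longleftrightarrow> linear_lie_rack rk \<and>
     (\<exists>A :: nat \<Rightarrow> 'a list \<Rightarrow> 'a \<Rightarrow> 'a.
        (\<forall>n xs. length xs = n \<longrightarrow> linear (A n xs)) \<and>
        (\<forall>n y. multilinear n (\<lambda>xs. A n xs y)) \<and>
        (\<forall>n y. symmetric_args n (\<lambda>xs. A n xs y)) \<and>
        (\<forall>x y. (\<lambda>n. A (Suc n) (replicate (Suc n) x) y) sums (rk x y - y)))"

definition rack_bracket_is :: "('a::euclidean_space \<Rightarrow> 'a \<Rightarrow> 'a) \<Rightarrow> ('a \<Rightarrow> 'a \<Rightarrow> 'a) \<Rightarrow> bool" where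
  "rack_bracket_is rk br \<longleftrightarrow>
     (\<forall>u v. ((\<lambda>t. rk (t *\<^sub>R u) v) has_vector_derivative br u v) (at 0))"

definition real_analytic_fun :: "(real \<Rightarrow> real) \<Rightarrow> bool" where
  "real_analytic_fun F \<longleftrightarrow> (\<forall>a. \<exists>r>0. \<exists>c :: nat \<Rightarrow> real.
      \<forall>t. \<bar>t - a\<bar> < r \<longrightarrow> (\<lambda>n. c n * (t - a) ^ n) sums F t)"

definition exp_ad :: "('a::euclidean_space \<Rightarrow> 'a \<Rightarrow> 'a) \<Rightarrow> real \<Rightarrow> 'a \<Rightarrow> 'a \<Rightarrow> 'a" where
  "exp_ad br c x y = (\<Sum>k. ((c ^ k) / fact k) *\<^sub>R ((br x ^^ k) y))"

definition invariant_form :: "('a::euclidean_space \<Rightarrow> 'a \<Rightarrow> 'a) \<Rightarrow> nat \<Rightarrow> ('a list \<Rightarrow> real) \<Rightarrow> bool" where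
  "invariant_form br p P \<longleftrightarrow> multilinear p P \<and> symmetric_args p P \<and>
     (\<forall>y xs. length xs = p \<longrightarrow> (\<Sum>i<p. P (xs[i := br y (xs ! i)])) = 0)"

definition rigid :: "('a::euclidean_space \<Rightarrow> 'a \<Rightarrow> 'a) \<Rightarrow> bool" where
  "rigid br \<longleftrightarrow> (\<forall>rk. analytic_rack rk \<and> rack_bracket_is rk br \<longrightarrow>
     (\<exists>F p P. real_analytic_fun F \<and> F 0 = 1 \<and> invariant_form br p P \<and>
        (\<forall>x y. rk x y = exp_ad br (F (P (replicate p x))) x y)))"

end

theory Submission
  imports Defs
begin

text \<open>
  Let \<open>a\<close> be central and let \<open>\<xi>\<close>, \<open>\<theta>\<close> be linear functionals vanishing on \<open>[h, h]\<close>, with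
  \<open>\<xi>(a) = 0\<close> and \<open>\<theta>(a) \<ge> 0\<close>. Then \<open>x \<rhd> y = e\<^sup>a\<^sup>d \<^sup>x y + \<xi>(x)\<^sup>2 \<theta>(y) a\<close> is an analytic linear
  Lie rack with bracket \<open>[\<cdot>, \<cdot>]\<close>: \<open>e\<^sup>a\<^sup>d \<^sup>x\<close> is an automorphism fixing \<open>a\<close> and preserving \<open>\<xi>\<close>
  and \<open>\<theta>\<close>, and the extra term is quadratic in \<open>x\<close>. Smoothness and analyticity hold because
  both terms are entire series of multilinear maps. If \<open>\<xi>(x\<^sub>0) = 1\<close>, \<open>[x\<^sub>0, w] = 0\<close> and
  \<open>\<theta>(w) \<noteq> 0\<close>, then \<open>x\<^sub>0 \<rhd> w = w + \<theta>(w) a \<noteq> w\<close>, whereas every rack of the form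
  \<open>exp(F(P(x, \<dots>, x)) ad x)\<close> fixes \<open>w\<close>. The hypothesis \<open>[h, h] + Z(h) \<noteq> h\<close> provides \<open>\<xi>\<close>
  and \<open>x\<^sub>0\<close>. In case (1) take \<open>\<theta> = \<xi>\<close> and \<open>w = x\<^sub>0\<close>, using \<open>[x\<^sub>0, x\<^sub>0] = 0\<close>; in case (2)
  take \<open>a \<notin> [h, h]\<close>, \<open>\<theta>(a) = 1\<close> and \<open>w = a\<close>.
\<close>

lemma suminf_eq_single:
  fixes f :: "nat \<Rightarrow> 'a::{t2_space,comm_monoid_add}"
  assumes "\<And>n. n \<noteq> i \<Longrightarrow> f n = 0"
  shows "suminf f = f i"
  using suminf_finite[of "{i}" f] assms by simp

lemma linear_suminf:
  fixes f :: "nat \<Rightarrow> 'c::real_vector \<Rightarrow> 'd::real_normed_vector"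
  assumes "\<And>n. linear (f n)" "\<And>y. summable (\<lambda>n. f n y)"
  shows "linear (\<lambda>y. \<Sum>n. f n y)"
proof (rule linearI)
  show "(\<Sum>n. f n (b1 + b2)) = (\<Sum>n. f n b1) + (\<Sum>n. f n b2)" for b1 b2
    using assms by (simp add: linear_add suminf_add)
  show "(\<Sum>n. f n (r *\<^sub>R b)) = r *\<^sub>R (\<Sum>n. f n b)" for r b
    using assms by (simp add: linear_scale suminf_scaleR_right)
qed

text \<open>The proof of \<open>Cauchy_product_sums\<close>, with the multiplication of an algebra replaced
  by an arbitrary bounded bilinear map.\<close>
lemma bounded_bilinear_Cauchy_product_sums:
  fixes a :: "nat \<Rightarrow> 'a::banach" and b :: "nat \<Rightarrow> 'b::banach"
    and pr :: "'a \<Rightarrow> 'b \<Rightarrow> 'c::real_normed_vector"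
  assumes bb: "bounded_bilinear pr"
    and a: "summable (\<lambda>k. norm (a k))"
    and b: "summable (\<lambda>k. norm (b k))"
  shows "(\<lambda>k. \<Sum>i\<le>k. pr (a i) (b (k - i))) sums (pr (\<Sum>k. a k) (\<Sum>k. b k))"
proof -
  obtain K where K: "\<And>x y. norm (pr x y) \<le> norm x * norm y * K"
    using bounded_bilinear.bounded[OF bb] by blast
  let ?S1 = "\<lambda>n::nat. {..<n} \<times> {..<n}"
  let ?S2 = "\<lambda>n::nat. {(i,j). i + j < n}"
  have S1_mono: "\<And>m n. m \<le> n \<Longrightarrow> ?S1 m \<subseteq> ?S1 n" by auto
  have S2_le_S1: "\<And>n. ?S2 n \<subseteq> ?S1 n" by auto
  have S1_le_S2: "\<And>n. ?S1 (n div 2) \<subseteq> ?S2 n" by auto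
  have finite_S1: "\<And>n. finite (?S1 n)" by simp
  let ?g = "\<lambda>(i,j). pr (a i) (b j)"
  let ?f = "\<lambda>(i,j). norm (a i) * norm (b j)"
  have f_nonneg: "\<And>x. 0 \<le> ?f x" by auto
  then have norm_sum_f: "\<And>A. norm (sum ?f A) = sum ?f A"
    by (simp add: sum_nonneg)
  have "pr (\<Sum>k<n. a k) (\<Sum>k<n. b k) = (\<Sum>i<n. pr (a i) (\<Sum>k<n. b k))" for n
    by (rule bounded_bilinear.sum_left[OF bb])
  also have "\<dots> n = sum ?g (?S1 n)" for n
    by (simp add: bounded_bilinear.sum_right[OF bb] sum.cartesian_product')
  moreover have "(\<lambda>n. pr (\<Sum>k<n. a k) (\<Sum>k<n. b k)) \<longlonglongrightarrow> pr (\<Sum>k. a k) (\<Sum>k. b k)"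
    by (intro bounded_bilinear.tendsto[OF bb] summable_LIMSEQ summable_norm_cancel[OF a]
        summable_norm_cancel[OF b])
  ultimately have lim_S1: "(\<lambda>n. sum ?g (?S1 n)) \<longlonglongrightarrow> pr (\<Sum>k. a k) (\<Sum>k. b k)"
    by simp
  have "(\<lambda>n. (\<Sum>k<n. norm (a k)) * (\<Sum>k<n. norm (b k)))
      \<longlonglongrightarrow> (\<Sum>k. norm (a k)) * (\<Sum>k. norm (b k))"
    using a b by (intro tendsto_mult summable_LIMSEQ)
  then have "convergent (\<lambda>n. sum ?f (?S1 n))"
    by (simp only: sum_product sum.Sigma[rule_format] finite_lessThan convergentI)
  then have Cauchy: "Cauchy (\<lambda>n. sum ?f (?S1 n))"
    by (rule convergent_Cauchy)
  have "Zfun (\<lambda>n. sum ?f (?S1 n - ?S2 n)) sequentially"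
  proof (rule ZfunI, simp only: eventually_sequentially norm_sum_f)
    fix r :: real
    assume r: "0 < r"
    from CauchyD[OF Cauchy r] obtain N
      where "\<forall>m\<ge>N. \<forall>n\<ge>N. norm (sum ?f (?S1 m) - sum ?f (?S1 n)) < r" ..
    then have "\<And>m n. N \<le> n \<Longrightarrow> n \<le> m \<Longrightarrow> norm (sum ?f (?S1 m - ?S1 n)) < r"
      by (simp only: sum_diff finite_S1 S1_mono)
    then have N: "\<And>m n. N \<le> n \<Longrightarrow> n \<le> m \<Longrightarrow> sum ?f (?S1 m - ?S1 n) < r"
      by (simp only: norm_sum_f)
    show "\<exists>N. \<forall>n\<ge>N. sum ?f (?S1 n - ?S2 n) < r"
    proof (intro exI allI impI)
      fix n
      assume "2 * N \<le> n"
      then have n: "N \<le> n div 2" by simp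
      have "sum ?f (?S1 n - ?S2 n) \<le> sum ?f (?S1 n - ?S1 (n div 2))"
        by (intro sum_mono2 finite_Diff finite_S1 f_nonneg Diff_mono subset_refl S1_le_S2)
      also have "\<dots> < r"
        using n div_le_dividend by (rule N)
      finally show "sum ?f (?S1 n - ?S2 n) < r" .
    qed
  qed
  then have "Zfun (\<lambda>n. sum ?g (?S1 n - ?S2 n)) sequentially"
  proof (rule Zfun_imp_Zfun[where K = K], intro always_eventually allI)
    show "norm (sum ?g (?S1 n - ?S2 n)) \<le> norm (sum ?f (?S1 n - ?S2 n)) * K" for n
      unfolding norm_sum_f sum_distrib_right
      by (rule order_trans[OF norm_sum sum_mono]) (use K in auto)
  qed
  then have "(\<lambda>n. sum ?g (?S1 n) - sum ?g (?S2 n)) \<longlonglongrightarrow> 0"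
    unfolding tendsto_Zfun_iff diff_0_right
    by (simp only: sum_diff finite_S1 S2_le_S1)
  with lim_S1 have "(\<lambda>n. sum ?g (?S2 n)) \<longlonglongrightarrow> pr (\<Sum>k. a k) (\<Sum>k. b k)"
    by (rule Lim_transform2)
  then show ?thesis
    by (simp only: sums_def sum.triangle_reindex)
qed

section \<open>Smooth functions given by entire series of multilinear maps\<close>

text \<open>A series \<open>M\<close> with \<open>M n\<close> an \<open>n\<close>-linear map represents the function
  \<open>z \<mapsto> \<Sum>n. M n [z, \<dots>, z]\<close>; a factorial bound on its coefficients makes the series
  converge everywhere together with all its termwise derivatives.\<close>

definition factorial_bounded ::
    "(nat \<Rightarrow> 'c::real_normed_vector list \<Rightarrow> 'b::real_normed_vector) \<Rightarrow> real \<Rightarrow> real \<Rightarrow> bool" where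
  "factorial_bounded M C K \<longleftrightarrow>
     (\<forall>n xs. length xs = n \<longrightarrow> norm (M n xs) \<le> C * K ^ n / fact n * prod_list (map norm xs))"

definition entire_mseries :: "(nat \<Rightarrow> 'c::real_normed_vector list \<Rightarrow> 'b::real_normed_vector) \<Rightarrow> bool" where
  "entire_mseries M \<longleftrightarrow> (\<forall>n. multilinear n (M n)) \<and> (\<exists>C K. 0 \<le> C \<and> 0 \<le> K \<and> factorial_bounded M C K)"

definition mseries_sum :: "(nat \<Rightarrow> 'c list \<Rightarrow> 'b::real_normed_vector) \<Rightarrow> 'c \<Rightarrow> 'b" where
  "mseries_sum M z = (\<Sum>n. M n (replicate n z))"

definition term_deriv :: "(nat \<Rightarrow> 'c list \<Rightarrow> 'b::real_vector) \<Rightarrow> 'c \<Rightarrow> 'c \<Rightarrow> nat \<Rightarrow> 'b" where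
  "term_deriv M z h n = (\<Sum>i<n. M n ((replicate n z)[i := h]))"

definition insert_at :: "nat \<Rightarrow> 'c \<Rightarrow> 'c list \<Rightarrow> 'c list" where
  "insert_at i v zs = take i zs @ v # drop i zs"

definition mseries_deriv :: "'c \<Rightarrow> (nat \<Rightarrow> 'c list \<Rightarrow> 'b::real_vector) \<Rightarrow> nat \<Rightarrow> 'c list \<Rightarrow> 'b" where
  "mseries_deriv v M m zs = (\<Sum>i\<le>m. M (Suc m) (insert_at i v zs))"

fun mseries_higher_deriv ::
    "(nat \<Rightarrow> 'c list \<Rightarrow> 'b::real_vector) \<Rightarrow> 'c list \<Rightarrow> nat \<Rightarrow> 'c list \<Rightarrow> 'b" where
  "mseries_higher_deriv M [] = M"
| "mseries_higher_deriv M (v # vs) = mseries_deriv v (mseries_higher_deriv M vs)"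

lemma multilinearD:
  assumes "multilinear n F" "length xs = n" "i < n"
  shows "linear (\<lambda>v. F (xs[i := v]))"
  using assms unfolding multilinear_def by blast

lemma multilinear_zero_arg:
  assumes "multilinear n F" "length xs = n" "i < n" "xs ! i = 0"
  shows "F xs = 0"
  using linear_0[OF multilinearD[OF assms(1-3)]] assms(4) by (metis list_update_id)

lemma factorial_boundedD:
  assumes "factorial_bounded M C K" "length xs = n"
  shows "norm (M n xs) \<le> C * K ^ n / fact n * prod_list (map norm xs)"
  using assms unfolding factorial_bounded_def by blast

lemma entire_mseriesE:
  assumes "entire_mseries M"
  obtains C K where "0 \<le> C" "0 \<le> K" "factorial_bounded M C K" "\<And>n. multilinear n (M n)"
  using assms unfolding entire_mseries_def by blast

lemma multilinear_diff_telescope: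
  assumes F: "multilinear n F" and len: "length A = n" "length B = n"
  shows "F A - F B = (\<Sum>i<n. F ((take i A @ drop i B)[i := A ! i - B ! i]))"
proof -
  define mix where "mix i = take i A @ drop i B" for i
  have len_mix: "length (mix i) = n" for i
    using len by (simp add: mix_def)
  have mix_nth: "mix i ! k = (if k < i then A ! k else B ! k)" if "k < n" for i k
    using that len by (auto simp: mix_def nth_append min_def)
  have "(\<Sum>i<n. F (mix (Suc i)) - F (mix i)) = F (mix n) - F (mix 0)"
    by (rule sum_lessThan_telescope)
  moreover have "mix n = A" "mix 0 = B"
    using len by (auto simp: mix_def)
  moreover have "F (mix (Suc i)) - F (mix i) = F ((mix i)[i := A ! i - B ! i])" if i: "i < n" for i
  proof -
    have "mix (Suc i) = (mix i)[i := A ! i]" "mix i = (mix i)[i := B ! i]"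
      using i len by (auto intro!: nth_equalityI simp: len_mix mix_nth nth_list_update)
    then show ?thesis
      using linear_diff[OF multilinearD[OF F len_mix i]] by metis
  qed
  ultimately show ?thesis
    by (simp add: mix_def)
qed

lemma prod_list_norm_le:
  fixes ws :: "'c::real_normed_vector list"
  assumes "length ws = n" "J \<subseteq> {..<n}"
    and "\<And>k. k < n \<Longrightarrow> k \<notin> J \<Longrightarrow> norm (ws ! k) \<le> t" "\<And>k. k \<in> J \<Longrightarrow> norm (ws ! k) \<le> s"
    and "0 \<le> s" "1 \<le> t"
  shows "prod_list (map norm ws) \<le> s ^ card J * t ^ n"
proof -
  have fJ: "finite J" using assms(2) finite_subset by blast
  have "prod_list (map norm ws) = (\<Prod>k\<in>J. norm (ws ! k)) * (\<Prod>k\<in>{..<n} - J. norm (ws ! k))"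
    using assms(1) prod.subset_diff[OF assms(2)]
    by (simp add: prod.list_conv_set_nth atLeast0LessThan mult.commute)
  also have "\<dots> \<le> s ^ card J * t ^ card ({..<n} - J)"
  proof (rule mult_mono)
    show "(\<Prod>k\<in>J. norm (ws ! k)) \<le> s ^ card J"
      using prod_mono[of J "\<lambda>k. norm (ws ! k)" "\<lambda>_. s"] assms(4) by simp
    show "(\<Prod>k\<in>{..<n} - J. norm (ws ! k)) \<le> t ^ card ({..<n} - J)"
      using prod_mono[of "{..<n} - J" "\<lambda>k. norm (ws ! k)" "\<lambda>_. t"] assms(3) by simp
  qed (use assms(5) in \<open>auto intro: prod_nonneg\<close>)
  also have "\<dots> \<le> s ^ card J * t ^ n"
    using assms(5,6) by (intro mult_left_mono power_increasing) (auto simp: card_Diff_subset[OF fJ assms(2)])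
  finally show ?thesis .
qed

lemma summable_square_factorial_series:
  fixes C K t :: real
  assumes "0 \<le> C" "0 \<le> K" "0 \<le> t"
  shows "summable (\<lambda>n. real n * real n * (C * K ^ n / fact n) * t ^ n)"
proof (rule summable_comparison_test[OF exI[of _ 0]])
  show "summable (\<lambda>n. C * (inverse (fact n) * (4 * K * t) ^ n))"
    by (intro summable_mult summable_exp)
  have "real n * real n \<le> 4 ^ n" for n
  proof -
    have "real n \<le> 2 ^ n"
      using less_exp[of n] by (metis of_nat_le_iff of_nat_numeral of_nat_power less_imp_le)
    then have "real n * real n \<le> 2 ^ n * 2 ^ n" by (intro mult_mono) auto
    then show ?thesis by (simp add: power_mult_distrib[symmetric])
  qed
  then have "real n * real n * (C * K ^ n / fact n * t ^ n) \<le> 4 ^ n * (C * K ^ n / fact n * t ^ n)"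
    for n using assms by (intro mult_right_mono) auto
  then show "\<forall>n\<ge>0. norm (real n * real n * (C * K ^ n / fact n) * t ^ n)
      \<le> C * (inverse (fact n) * (4 * K * t) ^ n)"
    using assms by (simp add: abs_mult field_simps)
qed

lemma power_div_fact_le_Suc:
  fixes K :: real
  assumes "0 \<le> K"
  shows "K ^ m / fact m \<le> (2 * (K + 1)) ^ Suc m / fact (Suc m)"
proof -
  have "K ^ m \<le> (K + 1) ^ m"
    using assms by (intro power_mono) auto
  also have "\<dots> \<le> (K + 1) ^ Suc m"
    using assms by (intro power_increasing) auto
  finally have "K ^ m \<le> (K + 1) ^ Suc m" .
  moreover have "real (Suc m) \<le> 2 ^ Suc m"
    using less_exp[of "Suc m"] by (metis less_imp_le of_nat_le_iff of_nat_numeral of_nat_power)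
  ultimately have "real (Suc m) * K ^ m \<le> 2 ^ Suc m * (K + 1) ^ Suc m"
    using assms by (intro mult_mono) auto
  then have "real (Suc m) * K ^ m \<le> (2 * (K + 1)) ^ Suc m"
    by (simp only: power_mult_distrib)
  then show ?thesis
    by (simp add: field_simps del: of_nat_Suc)
qed

lemma summable_mseries:
  fixes M :: "nat \<Rightarrow> 'c::real_normed_vector list \<Rightarrow> 'b::banach"
  assumes "factorial_bounded M C K" "0 \<le> C" "0 \<le> K"
  shows "summable (\<lambda>n. M n (replicate n z))"
proof (rule summable_comparison_test[OF exI[of _ 0]])
  show "summable (\<lambda>n. C * (inverse (fact n) * (K * norm z) ^ n))"
    by (intro summable_mult summable_exp)
  show "\<forall>n\<ge>0. norm (M n (replicate n z)) \<le> C * (inverse (fact n) * (K * norm z) ^ n)"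
    using factorial_boundedD[OF assms(1), of "replicate _ z"]
    by (simp add: prod_list_replicate field_simps power_mult_distrib)
qed

lemma linear_term_deriv: "multilinear n (M n) \<Longrightarrow> linear (\<lambda>h. term_deriv M z h n)"
  unfolding term_deriv_def by (rule linear_compose_sum) (auto intro: multilinearD)

lemma norm_term_deriv:
  assumes "factorial_bounded M C K" "0 \<le> C" "0 \<le> K" "norm z \<le> t" "1 \<le> t"
  shows "norm (term_deriv M z h n) \<le> real n * real n * (C * K ^ n / fact n) * t ^ n * norm h"
proof -
  have "norm (term_deriv M z h n) \<le> (\<Sum>i<n. norm (M n ((replicate n z)[i := h])))"
    unfolding term_deriv_def by (rule norm_sum)
  also have "\<dots> \<le> (\<Sum>i<n. C * K ^ n / fact n * (norm h ^ card {i} * t ^ n))"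
  proof (rule sum_mono)
    fix i assume i: "i \<in> {..<n}"
    have "norm (M n ((replicate n z)[i := h]))
        \<le> C * K ^ n / fact n * prod_list (map norm ((replicate n z)[i := h]))"
      using factorial_boundedD[OF assms(1), of "(replicate n z)[i := h]" n] by simp
    also have "\<dots> \<le> C * K ^ n / fact n * (norm h ^ card {i} * t ^ n)"
      using i assms by (intro mult_left_mono prod_list_norm_le[where n = n])
        (auto simp: nth_list_update)
    finally show "norm (M n ((replicate n z)[i := h])) \<le> C * K ^ n / fact n * (norm h ^ card {i} * t ^ n)" .
  qed
  also have "\<dots> = real n * (C * K ^ n / fact n * t ^ n * norm h)"
    by simp
  also have "\<dots> \<le> real n * real n * (C * K ^ n / fact n * t ^ n * norm h)"
    using assms by (intro mult_right_mono) (cases n, auto)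
  finally show ?thesis
    by (simp add: mult.assoc)
qed

lemma summable_term_deriv:
  fixes M :: "nat \<Rightarrow> 'c::real_normed_vector list \<Rightarrow> 'b::banach"
  assumes "factorial_bounded M C K" "0 \<le> C" "0 \<le> K"
  shows "summable (\<lambda>n. term_deriv M z h n)"
proof (rule summable_comparison_test[OF exI[of _ 0]])
  let ?t = "norm z + 1"
  show "summable (\<lambda>n. real n * real n * (C * K ^ n / fact n) * ?t ^ n * norm h)"
    by (intro summable_mult2 summable_square_factorial_series) (use assms in auto)
  show "\<forall>n\<ge>0. norm (term_deriv M z h n) \<le> real n * real n * (C * K ^ n / fact n) * ?t ^ n * norm h"
    using norm_term_deriv[OF assms] by auto
qed

text \<open>One summand of the second-order remainder of \<open>z \<mapsto> F [z, \<dots>, z]\<close>: both lists carry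
  \<open>h\<close> in slot \<open>i\<close>, and they differ by \<open>h\<close> in each slot \<open>j < i\<close>.\<close>
lemma norm_multilinear_remainder_summand:
  assumes F: "multilinear n F"
    and bound: "\<And>xs. length xs = n \<Longrightarrow> norm (F xs) \<le> c * prod_list (map norm xs)"
    and "0 \<le> c" "norm z + norm h \<le> t" "1 \<le> t" and i: "i < n"
  shows "norm (F ((take i (replicate n (z + h)) @ drop i (replicate n z))[i := h])
      - F ((replicate n z)[i := h])) \<le> real n * (c * (norm h ^ 2 * t ^ n))"
proof -
  define A where "A = (take i (replicate n (z + h)) @ drop i (replicate n z))[i := h]"
  define B where "B = (replicate n z)[i := h]"
  have lA: "length A = n" and lB: "length B = n"
    by (auto simp: A_def B_def)
  have A_nth: "A ! k = (if k = i then h else if k < i then z + h else z)" if "k < n" for k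
    using that by (auto simp: A_def nth_list_update nth_append min_def)
  have B_nth: "B ! k = (if k = i then h else z)" if "k < n" for k
    using that by (auto simp: B_def nth_list_update)
  have t: "norm z \<le> t" "norm (z + h) \<le> t"
    using assms(4) norm_triangle_ineq[of z h] norm_ge_zero[of h] by linarith+
  have "norm (F A - F B) \<le> (\<Sum>j<n. norm (F ((take j A @ drop j B)[j := A ! j - B ! j])))"
    unfolding multilinear_diff_telescope[OF F lA lB] by (rule norm_sum)
  also have "\<dots> \<le> (\<Sum>j<n. c * (norm h ^ 2 * t ^ n))"
  proof (rule sum_mono)
    fix j assume j: "j \<in> {..<n}"
    define w where "w = (take j A @ drop j B)[j := A ! j - B ! j]"
    have lw: "length w = n"
      by (simp add: w_def lA lB)
    have w_nth: "w ! k = (if k = j then A ! j - B ! j else if k < j then A ! k else B ! k)"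
      if "k < n" for k
      using that j lA lB by (auto simp: w_def nth_list_update nth_append min_def)
    show "norm (F w) \<le> c * (norm h ^ 2 * t ^ n)"
    proof (cases "j < i")
      case True
      have "prod_list (map norm w) \<le> norm h ^ card {i, j} * t ^ n"
        by (rule prod_list_norm_le[OF lw])
          (use i j True t assms(5) in \<open>auto simp: w_nth A_nth B_nth\<close>)
      also have "card {i, j} = 2"
        using True by auto
      finally show ?thesis
        using bound[OF lw] \<open>0 \<le> c\<close> by (meson mult_left_mono order_trans)
    next
      case False
      then have "w ! j = 0"
        using j i by (auto simp: w_nth A_nth B_nth)
      then show ?thesis
        using multilinear_zero_arg[OF F lw] j assms(3,5) by auto
    qed
  qed
  finally show ?thesis
    by (simp add: A_def B_def)
qed

lemma norm_term_remainder:
  assumes F: "multilinear n (M n)" and "factorial_bounded M C K" "0 \<le> C" "0 \<le> K"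
    and "norm z + norm h \<le> t" "1 \<le> t"
  shows "norm (M n (replicate n (z + h)) - M n (replicate n z) - term_deriv M z h n)
     \<le> real n * real n * (C * K ^ n / fact n) * t ^ n * norm h ^ 2"
proof -
  let ?A = "replicate n (z + h)" and ?B = "replicate n z"
  let ?c = "C * K ^ n / fact n"
  have "M n ?A - M n ?B = (\<Sum>i<n. M n ((take i ?A @ drop i ?B)[i := ?A ! i - ?B ! i]))"
    by (rule multilinear_diff_telescope[OF F]) simp_all
  also have "\<dots> = (\<Sum>i<n. M n ((take i ?A @ drop i ?B)[i := h]))"
    by (rule sum.cong) auto
  finally have "M n ?A - M n ?B - term_deriv M z h n
      = (\<Sum>i<n. M n ((take i ?A @ drop i ?B)[i := h]) - M n (?B[i := h]))"
    by (simp add: term_deriv_def sum_subtractf)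
  then have "norm (M n ?A - M n ?B - term_deriv M z h n)
      \<le> (\<Sum>i<n. norm (M n ((take i ?A @ drop i ?B)[i := h]) - M n (?B[i := h])))"
    by (simp add: norm_sum)
  also have "\<dots> \<le> (\<Sum>i<n. real n * (?c * (norm h ^ 2 * t ^ n)))"
    using assms factorial_boundedD[OF assms(2)]
    by (intro sum_mono norm_multilinear_remainder_summand[OF F]) auto
  also have "\<dots> = real n * real n * ?c * t ^ n * norm h ^ 2"
    by simp
  finally show ?thesis .
qed

lemma mseries_sum_has_derivative:
  fixes M :: "nat \<Rightarrow> 'c::euclidean_space list \<Rightarrow> 'b::banach"
  assumes "entire_mseries M"
  shows "(mseries_sum M has_derivative (\<lambda>h. \<Sum>n. term_deriv M z h n)) (at z)"
proof -
  obtain C K where CK: "0 \<le> C" "0 \<le> K" "factorial_bounded M C K"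
    and lin: "\<And>n. multilinear n (M n)"
    using entire_mseriesE[OF assms] by blast
  define t where "t = norm z + 1"
  define g where "g n = real n * real n * (C * K ^ n / fact n) * t ^ n" for n
  have g: "summable g"
    unfolding g_def by (rule summable_square_factorial_series) (use CK in \<open>auto simp: t_def\<close>)
  define G where "G = suminf g"
  have G: "0 \<le> G"
    unfolding G_def using CK by (intro suminf_nonneg[OF g]) (auto simp: g_def t_def)
  have "linear (\<lambda>h. \<Sum>n. term_deriv M z h n)"
    by (rule linear_suminf) (auto intro: linear_term_deriv lin summable_term_deriv[OF CK(3,1,2)])
  then have "bounded_linear (\<lambda>h. \<Sum>n. term_deriv M z h n)"
    by (simp add: linear_conv_bounded_linear)
  then show ?thesis
    unfolding has_derivative_at_alt
  proof (intro conjI allI impI)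
    fix e :: real assume e: "0 < e"
    show "\<exists>d>0. \<forall>y. norm (y - z) < d \<longrightarrow>
        norm (mseries_sum M y - mseries_sum M z - (\<Sum>n. term_deriv M z (y - z) n)) \<le> e * norm (y - z)"
    proof (intro exI conjI allI impI)
      show "0 < min 1 (e / (G + 1))"
        using e G by simp
      fix y assume y: "norm (y - z) < min 1 (e / (G + 1))"
      define h where "h = y - z"
      have small: "norm h \<le> 1" "norm h \<le> e / (G + 1)"
        using y by (auto simp: h_def)
      have "mseries_sum M y - mseries_sum M z - (\<Sum>n. term_deriv M z h n)
          = (\<Sum>n. M n (replicate n (z + h)) - M n (replicate n z) - term_deriv M z h n)"
        unfolding mseries_sum_def h_def
        by (simp add: suminf_diff summable_mseries[OF CK(3,1,2)] summable_term_deriv[OF CK(3,1,2)]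
            summable_diff)
      also have "norm \<dots> \<le> (\<Sum>n. g n * norm h ^ 2)"
        using norm_term_remainder[OF lin CK(3,1,2), of z h t] small(1)
        by (intro norm_suminf_le summable_mult2[OF g]) (auto simp: g_def t_def)
      also have "\<dots> = G * norm h * norm h"
        unfolding G_def suminf_mult2[OF g, symmetric] by (simp add: power2_eq_square mult.assoc)
      also have "\<dots> \<le> e * norm h"
      proof (rule mult_right_mono)
        have "G * norm h \<le> G * (e / (G + 1))"
          by (rule mult_left_mono[OF small(2) G])
        also have "\<dots> \<le> e"
          using G e by (simp add: field_simps)
        finally show "G * norm h \<le> e" .
      qed simp
      finally show "norm (mseries_sum M y - mseries_sum M z - (\<Sum>n. term_deriv M z (y - z) n))
          \<le> e * norm (y - z)"
        by (simp add: h_def)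
    qed
  qed
qed

lemma insert_at_replicate:
  assumes "i \<le> m"
  shows "insert_at i h (replicate m z) = (replicate (Suc m) z)[i := h]"
proof -
  have "Suc m = i + Suc (m - i)"
    using assms by simp
  then have "replicate (Suc m) z = replicate i z @ replicate (Suc (m - i)) z"
    by (metis replicate_add)
  then show ?thesis
    using assms by (simp add: insert_at_def list_update_append)
qed

lemma insert_at_update:
  assumes "i \<le> length zs" "j < length zs"
  shows "insert_at i v (zs[j := u]) = (insert_at i v zs)[(if j < i then j else Suc j) := u]"
  using assms
  by (intro nth_equalityI) (auto simp: insert_at_def nth_append nth_list_update min_def nth_Cons')

lemma prod_list_norm_insert_at:
  "prod_list (map norm (insert_at i v zs)) = norm v * prod_list (map norm zs)"
proof -
  have "prod_list (map norm zs) = prod_list (map norm (take i zs)) * prod_list (map norm (drop i zs))"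
    by (metis append_take_drop_id map_append prod_list.append)
  then show ?thesis
    by (simp add: insert_at_def)
qed

lemma mseries_sum_mseries_deriv:
  fixes M :: "nat \<Rightarrow> 'c::real_normed_vector list \<Rightarrow> 'b::banach"
  assumes "entire_mseries M"
  shows "mseries_sum (mseries_deriv h M) z = (\<Sum>n. term_deriv M z h n)"
proof -
  obtain C K where CK: "0 \<le> C" "0 \<le> K" "factorial_bounded M C K"
    using assms unfolding entire_mseries_def by blast
  have "mseries_deriv h M m (replicate m z) = term_deriv M z h (Suc m)" for m
    unfolding mseries_deriv_def term_deriv_def lessThan_Suc_atMost
    by (rule sum.cong) (auto simp: insert_at_replicate)
  then have "mseries_sum (mseries_deriv h M) z = (\<Sum>m. term_deriv M z h (Suc m))"
    by (simp add: mseries_sum_def)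
  also have "\<dots> = (\<Sum>n. term_deriv M z h n) - term_deriv M z h 0"
    by (rule suminf_split_head[OF summable_term_deriv[OF CK(3,1,2)]])
  finally show ?thesis
    by (simp add: term_deriv_def)
qed

lemma multilinear_mseries_deriv:
  assumes "multilinear (Suc m) (M (Suc m))"
  shows "multilinear m (mseries_deriv v M m)"
  unfolding multilinear_def
proof (intro allI impI)
  fix j and zs :: "'a list" assume zs: "length zs = m \<and> j < m"
  have "linear (\<lambda>u. M (Suc m) ((insert_at i v zs)[(if j < i then j else Suc j) := u]))"
    if "i \<le> m" for i
    by (rule multilinearD[OF assms]) (use zs that in \<open>auto simp: insert_at_def\<close>)
  then show "linear (\<lambda>u. mseries_deriv v M m (zs[j := u]))"
    unfolding mseries_deriv_def using zs
    by (intro linear_compose_sum) (simp add: insert_at_update)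
qed

lemma factorial_bounded_mseries_deriv:
  assumes "factorial_bounded M C K"
  shows "factorial_bounded (mseries_deriv v M) (C * K * norm v) K"
  unfolding factorial_bounded_def
proof (intro allI impI)
  fix m and zs :: "'a list" assume zs: "length zs = m"
  let ?P = "prod_list (map norm zs)"
  have "norm (mseries_deriv v M m zs) \<le> (\<Sum>i\<le>m. norm (M (Suc m) (insert_at i v zs)))"
    unfolding mseries_deriv_def by (rule norm_sum)
  also have "\<dots> \<le> (\<Sum>i\<le>m. C * K ^ Suc m / fact (Suc m) * (norm v * ?P))"
  proof (rule sum_mono)
    fix i
    have "length (insert_at i v zs) = Suc m"
      using zs by (simp add: insert_at_def)
    from factorial_boundedD[OF assms this]
    show "norm (M (Suc m) (insert_at i v zs)) \<le> C * K ^ Suc m / fact (Suc m) * (norm v * ?P)"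
      by (simp only: prod_list_norm_insert_at)
  qed
  also have "\<dots> = real (Suc m) * (C * K ^ Suc m / fact (Suc m) * (norm v * ?P))"
    by simp
  also have "\<dots> = C * K * norm v * K ^ m / fact m * ?P"
  proof -
    have "0 < (fact m :: real)" "0 \<le> (fact m :: real) * real m"
      by simp_all
    then have "(fact m :: real) + fact m * real m \<noteq> 0"
      by linarith
    then show ?thesis
      by (simp add: field_simps)
  qed
  finally show "norm (mseries_deriv v M m zs) \<le> C * K * norm v * K ^ m / fact m * ?P" .
qed

lemma entire_mseries_deriv:
  assumes "entire_mseries M"
  shows "entire_mseries (mseries_deriv v M)"
proof -
  obtain C K where CK: "0 \<le> C" "0 \<le> K" "factorial_bounded M C K"
    and lin: "\<And>n. multilinear n (M n)"
    using entire_mseriesE[OF assms] by blast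
  show ?thesis
    unfolding entire_mseries_def
    using multilinear_mseries_deriv[where M = M, OF lin] factorial_bounded_mseries_deriv[OF CK(3)] CK
    by (intro conjI allI exI[of _ "C * K * norm v"] exI[of _ K]) simp_all
qed

lemma smooth_mseries_sum:
  fixes M :: "nat \<Rightarrow> 'c::euclidean_space list \<Rightarrow> 'b::banach"
  assumes "entire_mseries M"
  shows "smooth_map (mseries_sum M)"
  unfolding smooth_map_def
proof (intro exI[of _ "\<lambda>k z vs. mseries_sum (mseries_higher_deriv M vs) z"] conjI allI impI)
  fix k vs x
  have entire: "entire_mseries (mseries_higher_deriv M vs)"
    using assms by (induction vs) (auto intro: entire_mseries_deriv)
  then have "(mseries_sum (mseries_higher_deriv M vs) has_derivative
      (\<lambda>h. \<Sum>n. term_deriv (mseries_higher_deriv M vs) x h n)) (at x)"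
    by (rule mseries_sum_has_derivative)
  then show "((\<lambda>y. mseries_sum (mseries_higher_deriv M vs) y) has_derivative
      (\<lambda>v. mseries_sum (mseries_higher_deriv M (v # vs)) x)) (at x)"
    by (simp add: mseries_sum_mseries_deriv[OF entire])
qed simp

lemma smooth_map_add:
  assumes "smooth_map f" "smooth_map g"
  shows "smooth_map (\<lambda>z. f z + g z)"
proof -
  obtain Df where Df: "\<forall>x. Df 0 x [] = f x" "\<forall>k vs x. length vs = k \<longrightarrow>
      ((\<lambda>y. Df k y vs) has_derivative (\<lambda>v. Df (Suc k) x (v # vs))) (at x)"
    using assms(1) unfolding smooth_map_def by blast
  obtain Dg where Dg: "\<forall>x. Dg 0 x [] = g x" "\<forall>k vs x. length vs = k \<longrightarrow>
      ((\<lambda>y. Dg k y vs) has_derivative (\<lambda>v. Dg (Suc k) x (v # vs))) (at x)"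
    using assms(2) unfolding smooth_map_def by blast
  show ?thesis
    unfolding smooth_map_def
    by (rule exI[of _ "\<lambda>k x vs. Df k x vs + Dg k x vs"]) (use Df Dg in \<open>auto intro: has_derivative_add\<close>)
qed

lemma prod_list_norm_fst_le:
  "prod_list (map (\<lambda>z. norm (fst z)) zs) \<le> prod_list (map norm zs)"
proof (induction zs)
  case (Cons z zs)
  have "0 \<le> prod_list (map (\<lambda>z. norm (fst z)) zs)"
    by (rule prod_list_nonneg) auto
  then show ?case
    using Cons norm_fst_le[of "fst z" "snd z"] by (simp add: mult_mono)
qed simp

lemma map_permuted_update:
  assumes \<sigma>: "\<sigma> permutes {..<n}" and "length xs = n" "i < n"
  shows "map (\<lambda>k. xs[i := v] ! \<sigma> k) [0..<n] = (map (\<lambda>k. xs ! \<sigma> k) [0..<n])[inv \<sigma> i := v]"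
proof (rule nth_equalityI)
  fix k assume "k < length (map (\<lambda>k. xs[i := v] ! \<sigma> k) [0..<n])"
  then have k: "k < n" "\<sigma> k < n"
    using permutes_in_image[OF \<sigma>] by auto
  have "\<sigma> k = i \<longleftrightarrow> k = inv \<sigma> i"
    using permutes_inv_eq[OF \<sigma>, of i k] by auto
  then show "map (\<lambda>k. xs[i := v] ! \<sigma> k) [0..<n] ! k = (map (\<lambda>k. xs ! \<sigma> k) [0..<n])[inv \<sigma> i := v] ! k"
    using k assms(2) by (auto simp: nth_list_update)
qed simp

section \<open>The automorphisms \<open>e\<^sup>a\<^sup>d \<^sup>x\<close> of a left Leibniz algebra\<close>

locale leibniz_algebra =
  fixes br :: "'a::euclidean_space \<Rightarrow> 'a \<Rightarrow> 'a"
  assumes left_leibniz: "left_leibniz_algebra br"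
begin

lemma linear_br: "linear (br x)"
  using left_leibniz unfolding left_leibniz_algebra_def bilinear_bracket_def by blast

lemma linear_br_left: "linear (\<lambda>x. br x y)"
  using left_leibniz unfolding left_leibniz_algebra_def bilinear_bracket_def by blast

lemma leibniz_identity: "br u (br v w) = br (br u v) w + br v (br u w)"
  using left_leibniz unfolding left_leibniz_algebra_def by blast

sublocale br: bounded_bilinear br
  using linear_br linear_br_left by (simp add: bilinear_conv_bounded_bilinear[symmetric] bilinear_def)

lemmas [simp] = br.zero_left br.zero_right

lemma linear_ad_power: "linear (br x ^^ k)"
  by (induction k) (auto intro: linear_compose[unfolded o_def] linear_br simp: linear_id[unfolded id_def])

lemma norm_ad_power_le:
  assumes K: "\<And>x y. norm (br x y) \<le> norm x * norm y * K" "0 \<le> K"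
  shows "norm ((br x ^^ k) y) \<le> (K * norm x) ^ k * norm y"
proof (induction k)
  case (Suc k)
  have "norm ((br x ^^ Suc k) y) \<le> norm x * norm ((br x ^^ k) y) * K"
    using K(1) by simp
  also have "\<dots> \<le> norm x * ((K * norm x) ^ k * norm y) * K"
    using Suc K(2) by (intro mult_right_mono mult_left_mono) auto
  finally show ?case
    by (simp add: algebra_simps)
qed simp

lemma exp_ad_eq_self:
  assumes "br x w = 0"
  shows "exp_ad br c x w = w"
proof -
  have "(br x ^^ k) w = 0" if "k \<noteq> 0" for k
    using that
  proof (induction k)
    case (Suc k)
    then show ?case
      using assms by (cases k) auto
  qed simp
  then show ?thesis
    unfolding exp_ad_def by (subst suminf_eq_single[of 0]) auto
qed

definition Ad :: "'a \<Rightarrow> 'a \<Rightarrow> 'a" where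
  "Ad x = exp_ad br 1 x"

lemma Ad_eq_suminf: "Ad x y = (\<Sum>k. (1 / fact k) *\<^sub>R (br x ^^ k) y)"
  by (simp add: Ad_def exp_ad_def)

lemma summable_norm_Ad_series: "summable (\<lambda>k. norm ((1 / fact k) *\<^sub>R (br x ^^ k) y))"
proof -
  obtain K where K: "0 < K" "\<And>x y. norm (br x y) \<le> norm x * norm y * K"
    using br.pos_bounded by blast
  show ?thesis
  proof (rule summable_comparison_test[OF exI[of _ 0]])
    show "summable (\<lambda>k. norm y * (inverse (fact k) * (K * norm x) ^ k))"
      by (intro summable_mult summable_exp)
    show "\<forall>k\<ge>0. norm (norm ((1 / fact k) *\<^sub>R (br x ^^ k) y))
        \<le> norm y * (inverse (fact k) * (K * norm x) ^ k)"
      using norm_ad_power_le[OF K(2)] K(1)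
      by (auto simp: field_simps intro!: divide_right_mono)
  qed
qed

lemma sums_Ad: "(\<lambda>k. (1 / fact k) *\<^sub>R (br x ^^ k) y) sums Ad x y"
  unfolding Ad_eq_suminf by (rule summable_sums[OF summable_norm_cancel[OF summable_norm_Ad_series]])

lemma linear_Ad: "linear (Ad x)"
  unfolding Ad_eq_suminf[abs_def]
  by (rule linear_suminf)
    (auto intro: linear_compose_scale_right linear_ad_power summable_norm_cancel summable_norm_Ad_series)

lemma bounded_linear_Ad: "bounded_linear (Ad x)"
  using linear_Ad linear_conv_bounded_linear by blast

lemma Ad_eq_self: "br x w = 0 \<Longrightarrow> Ad x w = w"
  unfolding Ad_def by (rule exp_ad_eq_self)

lemma Ad_zero [simp]: "Ad 0 y = y"
  by (simp add: Ad_eq_self)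

lemma Ad_add_left_annihilator:
  assumes "\<And>u. br c u = 0"
  shows "Ad (x + c) = Ad x"
proof -
  have "br (x + c) = br x"
    using assms by (auto simp: br.add_left)
  then show ?thesis
    by (simp add: Ad_def exp_ad_def[abs_def])
qed

lemma functional_Ad:
  assumes "linear f" "\<And>u v. f (br u v) = (0::real)"
  shows "f (Ad x y) = f y"
proof -
  have "f (Ad x y) = (\<Sum>k. f ((1 / fact k) *\<^sub>R (br x ^^ k) y))"
    unfolding Ad_eq_suminf using assms(1)
    by (intro bounded_linear.suminf summable_norm_cancel[OF summable_norm_Ad_series])
      (simp add: linear_conv_bounded_linear)
  also have "\<dots> = f y"
  proof (rule suminf_eq_single[of 0, THEN trans])
    show "f ((1 / fact k) *\<^sub>R (br x ^^ k) y) = 0" if "k \<noteq> 0" for k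
      using that by (cases k) (auto simp: linear_scale[OF assms(1)] assms(2))
  qed simp
  finally show ?thesis .
qed

text \<open>\<open>Ad x\<close> is an automorphism: \<open>ad x\<close> is a derivation by the Leibniz identity, so the
  Cauchy product of the exponential series of \<open>y\<close> and \<open>z\<close> is that of \<open>br y z\<close>.\<close>
lemma Ad_br: "Ad x (br y z) = br (Ad x y) (Ad x z)"
proof -
  define a where "a i = (1 / fact i) *\<^sub>R (br x ^^ i) y" for i
  define b where "b j = (1 / fact j) *\<^sub>R (br x ^^ j) z" for j
  define p where "p i j = br (a i) (b j)" for i j
  define c where "c n = (\<Sum>i\<le>n. p i (n - i))" for n
  have xa: "br x (a i) = real (Suc i) *\<^sub>R a (Suc i)" for i
    using fact_gt_zero[of i] by (simp add: a_def br.scaleR_right field_simps add_nonneg_eq_0_iff)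
  have xb: "br x (b i) = real (Suc i) *\<^sub>R b (Suc i)" for i
    using fact_gt_zero[of i] by (simp add: b_def br.scaleR_right field_simps add_nonneg_eq_0_iff)
  have step: "br x (c n) = real (Suc n) *\<^sub>R c (Suc n)" for n
  proof -
    have "br x (c n) = (\<Sum>i\<le>n. br x (p i (n - i)))"
      unfolding c_def by (rule br.sum_right)
    also have "\<dots> = (\<Sum>i\<le>n. real (Suc i) *\<^sub>R p (Suc i) (n - i))
        + (\<Sum>i\<le>n. real (Suc n - i) *\<^sub>R p i (Suc n - i))"
      unfolding sum.distrib[symmetric]
    proof (rule sum.cong[OF refl])
      fix i assume "i \<in> {..n}"
      then have "Suc (n - i) = Suc n - i" by auto
      then show "br x (p i (n - i))
          = real (Suc i) *\<^sub>R p (Suc i) (n - i) + real (Suc n - i) *\<^sub>R p i (Suc n - i)"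
        unfolding p_def leibniz_identity xa xb by (simp add: br.scaleR_left br.scaleR_right)
    qed
    also have "(\<Sum>i\<le>n. real (Suc i) *\<^sub>R p (Suc i) (n - i)) = (\<Sum>i\<le>Suc n. real i *\<^sub>R p i (Suc n - i))"
      by (subst sum.atMost_Suc_shift) simp
    also have "(\<Sum>i\<le>n. real (Suc n - i) *\<^sub>R p i (Suc n - i))
        = (\<Sum>i\<le>Suc n. real (Suc n - i) *\<^sub>R p i (Suc n - i))"
      by simp
    also have "(\<Sum>i\<le>Suc n. real i *\<^sub>R p i (Suc n - i)) + (\<Sum>i\<le>Suc n. real (Suc n - i) *\<^sub>R p i (Suc n - i))
        = (\<Sum>i\<le>Suc n. real (Suc n) *\<^sub>R p i (Suc n - i))"
      unfolding sum.distrib[symmetric]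
      by (rule sum.cong[OF refl]) (auto simp: scaleR_add_left[symmetric] of_nat_diff)
    also have "\<dots> = real (Suc n) *\<^sub>R c (Suc n)"
      unfolding c_def by (rule scaleR_sum_right[symmetric])
    finally show ?thesis .
  qed
  have "c n = (1 / fact n) *\<^sub>R (br x ^^ n) (br y z)" for n
  proof (induction n)
    case (Suc n)
    have "c (Suc n) = (1 / real (Suc n)) *\<^sub>R br x (c n)"
      using step[of n] by simp
    then show ?case
      using Suc by (simp add: br.scaleR_right)
  qed (simp add: c_def p_def a_def b_def)
  then have "c = (\<lambda>k. (1 / fact k) *\<^sub>R (br x ^^ k) (br y z))"
    by (simp add: fun_eq_iff)
  then have "c sums Ad x (br y z)"
    using sums_Ad[of x "br y z"] by simp
  moreover have "c sums br (Ad x y) (Ad x z)"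
  proof -
    have "c sums br (suminf a) (suminf b)"
      unfolding c_def p_def
      by (rule bounded_bilinear_Cauchy_product_sums[OF br.bounded_bilinear_axioms])
        (use summable_norm_Ad_series in \<open>auto simp: a_def b_def\<close>)
    moreover have "suminf a = Ad x y" "suminf b = Ad x z"
      by (simp_all add: a_def[abs_def] b_def[abs_def] Ad_eq_suminf)
    ultimately show ?thesis
      by simp
  qed
  ultimately show ?thesis
    by (rule sums_unique2)
qed

lemma Ad_ad_power: "Ad x ((br y ^^ k) w) = (br (Ad x y) ^^ k) (Ad x w)"
  by (induction k) (auto simp: Ad_br)

lemma Ad_Ad: "Ad (Ad x y) (Ad x z) = Ad x (Ad y z)"
proof -
  have "Ad x (Ad y z) = (\<Sum>k. Ad x ((1 / fact k) *\<^sub>R (br y ^^ k) z))"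
    unfolding Ad_eq_suminf[of y]
    by (rule bounded_linear.suminf[OF bounded_linear_Ad summable_norm_cancel[OF summable_norm_Ad_series]])
  also have "\<dots> = (\<Sum>k. (1 / fact k) *\<^sub>R (br (Ad x y) ^^ k) (Ad x z))"
    by (simp add: linear_scale[OF linear_Ad] Ad_ad_power)
  finally show ?thesis
    by (simp add: Ad_eq_suminf)
qed

text \<open>The Cauchy product of the series of the operators \<open>e\<^sup>-\<^sup>a\<^sup>d \<^sup>x\<close> with that of
  \<open>e\<^sup>a\<^sup>d \<^sup>x z\<close> has the terms \<open>(\<Sum>i\<le>n. (-1)\<^sup>i (n choose i)) (ad x)\<^sup>n z / n!\<close>.\<close>
lemma Ad_neg_Ad: "Ad (- x) (Ad x z) = z"
proof -
  obtain K where K: "0 < K" "\<And>x y. norm (br x y) \<le> norm x * norm y * K"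
    using br.pos_bounded by blast
  have bl_pow: "bounded_linear (br x ^^ k)" for k
    using linear_ad_power linear_conv_bounded_linear by blast
  define a where "a k = ((-1) ^ k / fact k) *\<^sub>R Blinfun (br x ^^ k)" for k
  define b where "b j = (1 / fact j) *\<^sub>R (br x ^^ j) z" for j
  have a_apply: "blinfun_apply (a k) w = ((-1) ^ k / fact k) *\<^sub>R (br x ^^ k) w" for k w
    by (simp add: a_def blinfun.scaleR_left bounded_linear_Blinfun_apply[OF bl_pow])
  have "norm (a k) \<le> inverse (fact k) * (K * norm x) ^ k" for k
  proof -
    have "norm (a k) = (1 / fact k) * norm (Blinfun (br x ^^ k))"
      by (simp add: a_def norm_power)
    moreover have "norm (Blinfun (br x ^^ k)) \<le> (K * norm x) ^ k"
      by (rule norm_blinfun_bound)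
        (use K norm_ad_power_le[OF K(2)] in \<open>auto simp: bounded_linear_Blinfun_apply[OF bl_pow]\<close>)
    ultimately show ?thesis
      by (simp add: divide_inverse mult_left_mono)
  qed
  then have summable_a: "summable (\<lambda>k. norm (a k))"
    by (intro summable_comparison_test[OF exI[of _ 0] summable_exp]) auto
  have "(\<lambda>n. \<Sum>i\<le>n. blinfun_apply (a i) (b (n - i))) sums blinfun_apply (suminf a) (suminf b)"
    by (rule bounded_bilinear_Cauchy_product_sums[OF bounded_bilinear_blinfun_apply summable_a])
      (use summable_norm_Ad_series in \<open>simp add: b_def\<close>)
  moreover have "(\<Sum>i\<le>n. blinfun_apply (a i) (b (n - i))) = (if n = 0 then z else 0)" for n
  proof -
    have "(\<Sum>i\<le>n. blinfun_apply (a i) (b (n - i)))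
        = (\<Sum>i\<le>n. ((-1) ^ i * real (n choose i)) *\<^sub>R ((1 / fact n) *\<^sub>R (br x ^^ n) z))"
    proof (rule sum.cong[OF refl])
      fix i assume "i \<in> {..n}"
      then have i: "i \<le> n" by simp
      have "blinfun_apply (a i) (b (n - i))
          = ((-1) ^ i / fact i * (1 / fact (n - i))) *\<^sub>R (br x ^^ (i + (n - i))) z"
        by (simp add: a_apply b_def linear_scale[OF linear_ad_power] funpow_add)
      also have "\<dots> = ((-1) ^ i * real (n choose i)) *\<^sub>R ((1 / fact n) *\<^sub>R (br x ^^ n) z)"
        using i by (simp add: binomial_fact field_simps)
      finally show "blinfun_apply (a i) (b (n - i))
          = ((-1) ^ i * real (n choose i)) *\<^sub>R ((1 / fact n) *\<^sub>R (br x ^^ n) z)" .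
    qed
    also have "\<dots> = (\<Sum>i\<le>n. (-1) ^ i * real (n choose i)) *\<^sub>R ((1 / fact n) *\<^sub>R (br x ^^ n) z)"
      by (rule scaleR_sum_left[symmetric])
    also have "\<dots> = (if n = 0 then z else 0)"
      using choose_alternating_sum[of n, where 'a = real] by auto
    finally show ?thesis .
  qed
  ultimately have "(\<lambda>n. if n = 0 then z else 0) sums blinfun_apply (suminf a) (suminf b)"
    by simp
  then have "blinfun_apply (suminf a) (suminf b) = z"
    using sums_single[of 0 "\<lambda>_. z"] sums_unique2 by force
  moreover have "suminf b = Ad x z"
    by (simp add: b_def[abs_def] Ad_eq_suminf)
  moreover have "blinfun_apply (suminf a) w = Ad (- x) w" for w
  proof -
    have "blinfun_apply (suminf a) w = (\<Sum>k. blinfun_apply (a k) w)"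
      by (rule bounded_linear.suminf[OF blinfun.bounded_linear_left summable_norm_cancel[OF summable_a]])
    also have "\<dots> = Ad (- x) w"
    proof -
      have "(br (- x) ^^ k) w = (-1) ^ k *\<^sub>R (br x ^^ k) w" for k
        by (induction k) (auto simp: br.minus_left br.scaleR_right)
      then show ?thesis
        by (simp add: Ad_eq_suminf a_apply)
    qed
    finally show ?thesis .
  qed
  ultimately show ?thesis
    by simp
qed

lemma linear_foldr_br: "linear (foldr br ws)"
proof (induction ws)
  case (Cons w ws)
  then show ?case
    using linear_compose[OF Cons linear_br[of w]] by (simp add: o_def)
qed (simp add: linear_id[unfolded id_def])

lemma linear_foldr_br_update: "j < length ws \<Longrightarrow> linear (\<lambda>v. foldr br (ws[j := v]) y)"
proof (induction ws arbitrary: j)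
  case (Cons w ws)
  show ?case
  proof (cases j)
    case 0
    then show ?thesis
      by (simp add: linear_br_left)
  next
    case (Suc j')
    then have "j' < length ws"
      using Cons by simp
    from linear_compose[OF Cons.IH[OF this] linear_br[of w]] show ?thesis
      by (simp add: Suc o_def)
  qed
qed simp

lemma foldr_br_zero: "j < length ws \<Longrightarrow> ws ! j = 0 \<Longrightarrow> foldr br ws y = 0"
  using linear_0[OF linear_foldr_br_update[of j ws y]] by (metis list_update_id)

lemma norm_foldr_br_le:
  assumes K: "\<And>x y. norm (br x y) \<le> norm x * norm y * K" "0 \<le> K"
  shows "norm (foldr br ws y) \<le> K ^ length ws * prod_list (map norm ws) * norm y"
proof (induction ws)
  case (Cons w ws)
  have "norm (foldr br (w # ws) y) \<le> norm w * norm (foldr br ws y) * K"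
    using K(1) by simp
  also have "\<dots> \<le> norm w * (K ^ length ws * prod_list (map norm ws) * norm y) * K"
    using Cons K(2) by (intro mult_right_mono mult_left_mono) auto
  finally show ?case
    by (simp add: algebra_simps)
qed simp

text \<open>The term of degree \<open>m + 1\<close> of \<open>(x, y) \<mapsto> e\<^sup>a\<^sup>d \<^sup>x y\<close>: the first \<open>m\<close> arguments
  supply the \<open>x\<close>'s of \<open>(ad x)\<^sup>m y / m!\<close>, the last one supplies \<open>y\<close>.\<close>
definition Ad_mseries :: "nat \<Rightarrow> ('a \<times> 'a) list \<Rightarrow> 'a" where
  "Ad_mseries n zs = (case n of 0 \<Rightarrow> 0
     | Suc m \<Rightarrow> (1 / fact m) *\<^sub>R foldr br (map fst (take m zs)) (snd (zs ! m)))"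

lemma mseries_sum_Ad_mseries: "mseries_sum Ad_mseries (x, y) = Ad x y"
proof -
  have "(\<lambda>m. Ad_mseries (Suc m) (replicate (Suc m) (x, y))) = (\<lambda>k. (1 / fact k) *\<^sub>R (br x ^^ k) y)"
    by (simp add: Ad_mseries_def take_replicate foldr_replicate del: replicate_Suc)
  then have "(\<lambda>m. Ad_mseries (Suc m) (replicate (Suc m) (x, y))) sums Ad x y"
    using sums_Ad by simp
  then have "(\<lambda>n. Ad_mseries n (replicate n (x, y))) sums (Ad x y + Ad_mseries 0 [])"
    using sums_Suc_iff[of "\<lambda>n. Ad_mseries n (replicate n (x, y))"] by simp
  then have "(\<lambda>n. Ad_mseries n (replicate n (x, y))) sums Ad x y"
    by (simp add: Ad_mseries_def)
  then show ?thesis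
    unfolding mseries_sum_def by (simp add: sums_iff)
qed

lemma multilinear_Ad_mseries: "multilinear n (Ad_mseries n)"
  unfolding multilinear_def
proof (intro allI impI)
  fix xs :: "('a \<times> 'a) list" and i assume xs: "length xs = n \<and> i < n"
  then obtain m where n: "n = Suc m"
    by (cases n) auto
  show "linear (\<lambda>v. Ad_mseries n (xs[i := v]))"
  proof (cases "i < m")
    case True
    have "(\<lambda>v. Ad_mseries n (xs[i := v]))
        = (\<lambda>u. (1 / fact m) *\<^sub>R foldr br ((map fst (take m xs))[i := u]) (snd (xs ! m))) \<circ> fst"
      using True xs n by (auto simp: Ad_mseries_def take_update_swap map_update nth_list_update)
    then show ?thesis
      using True xs n
      by (auto intro!: linear_compose[OF linear_fst] linear_compose_scale_right linear_foldr_br_update)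
  next
    case False
    then have "i = m"
      using xs n by simp
    then have "(\<lambda>v. Ad_mseries n (xs[i := v])) = (\<lambda>u. (1 / fact m) *\<^sub>R foldr br (map fst (take m xs)) u) \<circ> snd"
      using xs n by (auto simp: Ad_mseries_def)
    then show ?thesis
      by (auto intro!: linear_compose[OF linear_snd] linear_compose_scale_right linear_foldr_br)
  qed
qed

lemma norm_Ad_mseries_Suc_le:
  assumes K: "\<And>x y. norm (br x y) \<le> norm x * norm y * K" "0 \<le> K" and xs: "length xs = Suc m"
  shows "norm (Ad_mseries (Suc m) xs) \<le> K ^ m / fact m * prod_list (map norm xs)"
proof -
  let ?ws = "map fst (take m xs)"
  have xs_split: "xs = take m xs @ [xs ! m]"
    using xs take_Suc_conv_app_nth[of m xs] by simp
  have xs_prod: "prod_list (map norm xs) = prod_list (map norm (take m xs)) * norm (xs ! m)"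
    by (subst xs_split) simp
  have "0 \<le> prod_list (map norm (take m xs))"
    by (rule prod_list_nonneg) auto
  then have "prod_list (map norm ?ws) * norm (snd (xs ! m)) \<le> prod_list (map norm xs)"
    unfolding xs_prod
    using prod_list_norm_fst_le[of "take m xs"] norm_snd_le[of "snd (xs ! m)" "fst (xs ! m)"]
    by (intro mult_mono) (auto simp: o_def)
  then have "K ^ m * (prod_list (map norm ?ws) * norm (snd (xs ! m))) \<le> K ^ m * prod_list (map norm xs)"
    using K(2) by (simp add: mult_left_mono)
  then have "norm (foldr br ?ws (snd (xs ! m))) \<le> K ^ m * prod_list (map norm xs)"
    using norm_foldr_br_le[OF K, of ?ws "snd (xs ! m)"] xs by (simp add: mult.assoc)
  then show ?thesis
    by (simp add: Ad_mseries_def divide_inverse mult_left_mono mult.assoc)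
qed

lemma factorial_bounded_Ad_mseries:
  assumes K: "\<And>x y. norm (br x y) \<le> norm x * norm y * K" "0 \<le> K"
  shows "factorial_bounded Ad_mseries 1 (2 * (K + 1))"
  unfolding factorial_bounded_def
proof (intro allI impI)
  fix n and xs :: "('a \<times> 'a) list" assume xs: "length xs = n"
  have P: "0 \<le> prod_list (map norm xs)"
    by (rule prod_list_nonneg) auto
  show "norm (Ad_mseries n xs) \<le> 1 * (2 * (K + 1)) ^ n / fact n * prod_list (map norm xs)"
  proof (cases n)
    case (Suc m)
    have "norm (Ad_mseries n xs) \<le> K ^ m / fact m * prod_list (map norm xs)"
      using norm_Ad_mseries_Suc_le[OF K] xs Suc by simp
    also have "\<dots> \<le> (2 * (K + 1)) ^ n / fact n * prod_list (map norm xs)"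
      using power_div_fact_le_Suc[OF K(2), of m] P Suc by (intro mult_right_mono) simp_all
    finally show ?thesis
      by simp
  qed (use P in \<open>simp add: Ad_mseries_def\<close>)
qed

lemma entire_Ad_mseries: "entire_mseries Ad_mseries"
proof -
  obtain K where K: "0 < K" "\<And>x y. norm (br x y) \<le> norm x * norm y * K"
    using br.pos_bounded by blast
  show ?thesis
    unfolding entire_mseries_def
    using multilinear_Ad_mseries factorial_bounded_Ad_mseries[OF K(2)] K(1)
    by (intro conjI allI exI[of _ 1] exI[of _ "2 * (K + 1)"]) simp_all
qed

lemma term_deriv_Ad_mseries_at_0: "term_deriv Ad_mseries (0, v) (u, 0) n = (if n = 2 then br u v else 0)"
proof -
  consider "n = 0" | "n = 1" | "n = 2" | m where "n = Suc (Suc (Suc m))"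
    by (metis One_nat_def Suc_1 not0_implies_Suc)
  then show ?thesis
  proof cases
    case 4
    text \<open>Every term has \<open>(0, v)\<close> in some slot \<open>p \<noteq> i\<close> feeding an \<open>x\<close> of \<open>(ad x)\<^sup>m y\<close>.\<close>
    have "Ad_mseries n ((replicate n (0, v))[i := (u, 0)]) = 0" if i: "i < n" for i
    proof -
      define L where "L = (replicate n (0::'a, v))[i := (u, 0)]"
      define p where "p = (if i = 0 then 1 else (0::nat))"
      have p: "p < Suc (Suc m)" "p \<noteq> i"
        by (simp_all add: p_def)
      have len: "length L = n"
        by (simp add: L_def)
      have "map fst (take (Suc (Suc m)) L) ! p = 0"
        using 4 p by (simp add: L_def del: replicate_Suc)
      then have "foldr br (map fst (take (Suc (Suc m)) L)) (snd (L ! Suc (Suc m))) = 0"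
        by (rule foldr_br_zero[rotated]) (use 4 p len in simp)
      then show ?thesis
        by (simp add: 4 Ad_mseries_def L_def)
    qed
    then show ?thesis
      unfolding term_deriv_def using 4 by simp
  qed (auto simp: term_deriv_def Ad_mseries_def numeral_2_eq_2 lessThan_Suc)
qed

lemma Ad_has_vector_derivative: "((\<lambda>t. Ad (t *\<^sub>R u) v) has_vector_derivative br u v) (at 0)"
proof -
  define L where "L h = (\<Sum>n. term_deriv Ad_mseries (0, v) h n)" for h
  have "(mseries_sum Ad_mseries has_derivative L) (at ((\<lambda>t. (t *\<^sub>R u, v)) 0))"
    using mseries_sum_has_derivative[OF entire_Ad_mseries, of "(0, v)"] by (simp add: L_def[abs_def])
  then have "((mseries_sum Ad_mseries \<circ> (\<lambda>t. (t *\<^sub>R u, v))) has_derivative L \<circ> (\<lambda>t. (t *\<^sub>R u, 0))) (at 0)"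
    by (intro diff_chain_at) (auto intro!: derivative_eq_intros)
  moreover have "L \<circ> (\<lambda>t. (t *\<^sub>R u, 0)) = (\<lambda>t. t *\<^sub>R br u v)"
  proof
    fix t :: real
    have "L (u, 0) = br u v"
      unfolding L_def term_deriv_Ad_mseries_at_0 by (subst suminf_eq_single[of 2]) auto
    then show "(L \<circ> (\<lambda>t. (t *\<^sub>R u, 0))) t = t *\<^sub>R br u v"
      using linear_scale[OF has_derivative_linear[OF \<open>(mseries_sum Ad_mseries has_derivative L) _\<close>],
          of t "(u, 0)"]
      by simp
  qed
  moreover have "mseries_sum Ad_mseries \<circ> (\<lambda>t. (t *\<^sub>R u, v)) = (\<lambda>t. Ad (t *\<^sub>R u) v)"
    by (simp add: o_def mseries_sum_Ad_mseries)
  ultimately show ?thesis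
    by (simp add: has_vector_derivative_def)
qed

definition sym_ad_coeff :: "nat \<Rightarrow> 'a list \<Rightarrow> 'a \<Rightarrow> 'a" where
  "sym_ad_coeff n xs y = (1 / (fact n * fact n)) *\<^sub>R
     (\<Sum>\<sigma>\<in>{\<sigma>. \<sigma> permutes {..<n}}. foldr br (map (\<lambda>i. xs ! \<sigma> i) [0..<n]) y)"

lemma linear_sym_ad_coeff: "linear (sym_ad_coeff n xs)"
  unfolding sym_ad_coeff_def[abs_def]
  by (intro linear_compose_scale_right linear_compose_sum ballI linear_foldr_br)

lemma multilinear_sym_ad_coeff: "multilinear n (\<lambda>xs. sym_ad_coeff n xs y)"
  unfolding multilinear_def sym_ad_coeff_def
proof (intro allI impI linear_compose_scale_right linear_compose_sum ballI)
  fix xs :: "'a list" and i \<sigma> assume xs: "length xs = n \<and> i < n" and "\<sigma> \<in> {\<sigma>. \<sigma> permutes {..<n}}"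
  then have \<sigma>: "\<sigma> permutes {..<n}"
    by simp
  have "inv \<sigma> i < n"
    using permutes_in_image[OF permutes_inv[OF \<sigma>]] xs by auto
  then show "linear (\<lambda>v. foldr br (map (\<lambda>k. xs[i := v] ! \<sigma> k) [0..<n]) y)"
    unfolding map_permuted_update[OF \<sigma> conjunct1[OF xs] conjunct2[OF xs]]
    by (intro linear_foldr_br_update) simp
qed

lemma symmetric_sym_ad_coeff: "symmetric_args n (\<lambda>xs. sym_ad_coeff n xs y)"
  unfolding symmetric_args_def
proof (intro allI impI)
  fix xs ys :: "'a list" assume "length xs = n \<and> mset xs = mset ys"
  then have xs: "length xs = n" and m: "mset xs = mset ys"
    by auto
  obtain p where p: "p permutes {..<length ys}" "permute_list p ys = xs"
    using mset_eq_permutation[OF m] by blast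
  have pn: "p permutes {..<n}"
    using p(1) xs mset_eq_length[OF m] by simp
  have xs_nth: "xs ! k = ys ! p k" if "k < n" for k
    using permute_list_nth[OF p(1)] that xs mset_eq_length[OF m] p(2) by auto
  have "(\<Sum>\<sigma>\<in>{\<sigma>. \<sigma> permutes {..<n}}. foldr br (map (\<lambda>i. xs ! \<sigma> i) [0..<n]) y)
      = (\<Sum>\<tau>\<in>{\<sigma>. \<sigma> permutes {..<n}}. foldr br (map (\<lambda>i. ys ! \<tau> i) [0..<n]) y)"
  proof (rule sum.reindex_bij_witness[where j = "\<lambda>\<sigma>. p \<circ> \<sigma>" and i = "\<lambda>\<tau>. inv p \<circ> \<tau>"])
    fix \<sigma> assume "\<sigma> \<in> {\<sigma>. \<sigma> permutes {..<n}}"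
    then have \<sigma>: "\<sigma> permutes {..<n}"
      by simp
    show "inv p \<circ> (p \<circ> \<sigma>) = \<sigma>"
      by (simp add: o_assoc permutes_inv_o(2)[OF pn])
    show "p \<circ> \<sigma> \<in> {\<sigma>. \<sigma> permutes {..<n}}"
      using permutes_compose[OF \<sigma> pn] by simp
    have "map (\<lambda>i. ys ! (p \<circ> \<sigma>) i) [0..<n] = map (\<lambda>i. xs ! \<sigma> i) [0..<n]"
      by (rule map_cong[OF refl]) (use permutes_in_image[OF \<sigma>] xs_nth in auto)
    then show "foldr br (map (\<lambda>i. ys ! (p \<circ> \<sigma>) i) [0..<n]) y = foldr br (map (\<lambda>i. xs ! \<sigma> i) [0..<n]) y"
      by (rule arg_cong[where f = "\<lambda>L. foldr br L y"])
  next
    fix \<tau> assume "\<tau> \<in> {\<sigma>. \<sigma> permutes {..<n}}"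
    then have \<tau>: "\<tau> permutes {..<n}"
      by simp
    show "p \<circ> (inv p \<circ> \<tau>) = \<tau>"
      by (simp add: o_assoc permutes_inv_o(1)[OF pn])
    show "inv p \<circ> \<tau> \<in> {\<sigma>. \<sigma> permutes {..<n}}"
      using permutes_compose[OF \<tau> permutes_inv[OF pn]] by simp
  qed
  then show "sym_ad_coeff n xs y = sym_ad_coeff n ys y"
    by (simp add: sym_ad_coeff_def)
qed

lemma sym_ad_coeff_replicate: "sym_ad_coeff n (replicate n x) y = (1 / fact n) *\<^sub>R (br x ^^ n) y"
proof -
  have "foldr br (map (\<lambda>i. replicate n x ! \<sigma> i) [0..<n]) y = (br x ^^ n) y"
    if "\<sigma> permutes {..<n}" for \<sigma>
  proof -
    have "map (\<lambda>i. replicate n x ! \<sigma> i) [0..<n] = map (\<lambda>i. x) [0..<n]"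
      by (rule map_cong[OF refl]) (use permutes_in_image[OF that] in auto)
    then show ?thesis
      by (simp add: map_replicate_const foldr_replicate)
  qed
  then have "(\<Sum>\<sigma>\<in>{\<sigma>. \<sigma> permutes {..<n}}. foldr br (map (\<lambda>i. replicate n x ! \<sigma> i) [0..<n]) y)
      = fact n *\<^sub>R (br x ^^ n) y"
    using card_permutations[of "{..<n}" n] by (simp add: sum_constant_scaleR)
  then show ?thesis
    by (simp add: sym_ad_coeff_def)
qed

lemma zero_in_lcenter: "0 \<in> lcenter br"
  by (simp add: lcenter_def)

end

section \<open>A rack that is not of exponential form\<close>

lemma multilinear_scaleR_prod:
  fixes f :: "nat \<Rightarrow> 'c::real_vector \<Rightarrow> real"
  assumes "\<And>i. i < n \<Longrightarrow> linear (f i)"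
  shows "multilinear n (\<lambda>xs. (\<Prod>i<n. f i (xs ! i)) *\<^sub>R w)"
  unfolding multilinear_def
proof (intro allI impI)
  fix xs :: "'c list" and j assume xs: "length xs = n \<and> j < n"
  define c where "c = (\<Prod>i\<in>{..<n} - {j}. f i (xs ! i))"
  have "(\<Prod>i<n. f i (xs[j := v] ! i)) = f j v * c" for v
  proof -
    have "(\<Prod>i<n. f i (xs[j := v] ! i))
        = f j (xs[j := v] ! j) * (\<Prod>i\<in>{..<n} - {j}. f i (xs[j := v] ! i))"
      using xs by (intro prod.remove) auto
    also have "(\<Prod>i\<in>{..<n} - {j}. f i (xs[j := v] ! i)) = c"
      unfolding c_def by (rule prod.cong) auto
    finally show ?thesis
      using xs by simp
  qed
  then have eq: "(\<lambda>v. (\<Prod>i<n. f i (xs[j := v] ! i)) *\<^sub>R w) = (\<lambda>r. r *\<^sub>R (c *\<^sub>R w)) \<circ> f j"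
    by (simp add: fun_eq_iff)
  show "linear (\<lambda>v. (\<Prod>i<n. f i (xs[j := v] ! i)) *\<^sub>R w)"
    unfolding eq by (rule linear_compose[OF assms linear_scaleR_left]) (use xs in simp)
qed

lemma abs_prod_le_power_prod_list_norm:
  fixes f :: "nat \<Rightarrow> 'c::real_normed_vector \<Rightarrow> real"
  assumes "\<And>i z. i < n \<Longrightarrow> \<bar>f i z\<bar> \<le> B * norm z" "length xs = n"
  shows "\<bar>\<Prod>i<n. f i (xs ! i)\<bar> \<le> B ^ n * prod_list (map norm xs)"
proof -
  have "\<bar>\<Prod>i<n. f i (xs ! i)\<bar> = (\<Prod>i<n. \<bar>f i (xs ! i)\<bar>)"
    by (rule abs_prod)
  also have "\<dots> \<le> (\<Prod>i<n. B * norm (xs ! i))"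
    using assms(1) by (intro prod_mono) auto
  also have "\<dots> = B ^ n * prod_list (map norm xs)"
    using assms(2) by (simp add: prod.distrib prod.list_conv_set_nth atLeast0LessThan)
  finally show ?thesis .
qed

locale rack_deformation = leibniz_algebra br for br :: "'a::euclidean_space \<Rightarrow> 'a \<Rightarrow> 'a" +
  fixes a :: 'a and \<xi> \<theta> :: "'a \<Rightarrow> real"
  assumes central: "a \<in> lcenter br"
    and linear_xi: "linear \<xi>" and xi_br: "\<And>u v. \<xi> (br u v) = 0" and xi_a: "\<xi> a = 0"
    and linear_theta: "linear \<theta>" and theta_br: "\<And>u v. \<theta> (br u v) = 0" and theta_a: "0 \<le> \<theta> a"
begin

lemma br_central_left: "br a u = 0" and br_central_right: "br u a = 0"
  using central by (auto simp: lcenter_def)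

definition rack :: "'a \<Rightarrow> 'a \<Rightarrow> 'a" where
  "rack x y = Ad x y + (\<xi> x * \<xi> x * \<theta> y) *\<^sub>R a"

definition cubic_factor :: "nat \<Rightarrow> 'a \<times> 'a \<Rightarrow> real" where
  "cubic_factor i z = (if i < 2 then \<xi> (fst z) else \<theta> (snd z))"

definition cubic_mseries :: "nat \<Rightarrow> ('a \<times> 'a) list \<Rightarrow> 'a" where
  "cubic_mseries n zs = (if n = 3 then (\<Prod>i<n. cubic_factor i (zs ! i)) *\<^sub>R a else 0)"

lemma mseries_sum_cubic_mseries: "mseries_sum cubic_mseries (x, y) = (\<xi> x * \<xi> x * \<theta> y) *\<^sub>R a"
  unfolding mseries_sum_def
  by (subst suminf_eq_single[of 3])
    (simp_all add: cubic_mseries_def cubic_factor_def numeral_3_eq_3 lessThan_Suc)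

lemma linear_cubic_factor: "linear (cubic_factor i)"
  using linear_compose[OF linear_fst linear_xi] linear_compose[OF linear_snd linear_theta]
  by (cases "i < 2") (simp_all add: cubic_factor_def[abs_def] o_def)

lemma abs_cubic_factor_le: "\<bar>cubic_factor i z\<bar> \<le> (onorm \<xi> + onorm \<theta>) * norm z"
proof -
  have bl: "bounded_linear \<xi>" "bounded_linear \<theta>"
    using linear_xi linear_theta by (simp_all add: linear_conv_bounded_linear)
  note onorm_nonneg = onorm_pos_le[OF bl(1)] onorm_pos_le[OF bl(2)]
  have "\<bar>\<xi> (fst z)\<bar> \<le> onorm \<xi> * norm (fst z)" "\<bar>\<theta> (snd z)\<bar> \<le> onorm \<theta> * norm (snd z)"
    using onorm[OF bl(1)] onorm[OF bl(2)] by simp_all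
  moreover have "onorm \<xi> * norm (fst z) \<le> (onorm \<xi> + onorm \<theta>) * norm z"
    using norm_fst_le[of "fst z" "snd z"] onorm_nonneg by (intro mult_mono) auto
  moreover have "onorm \<theta> * norm (snd z) \<le> (onorm \<xi> + onorm \<theta>) * norm z"
    using norm_snd_le[of "snd z" "fst z"] onorm_nonneg by (intro mult_mono) auto
  ultimately show ?thesis
    by (simp add: cubic_factor_def)
qed

lemma multilinear_cubic_mseries: "multilinear n (cubic_mseries n)"
proof -
  have "multilinear 3 (\<lambda>zs. (\<Prod>i<3. cubic_factor i (zs ! i)) *\<^sub>R a)"
    by (rule multilinear_scaleR_prod[OF linear_cubic_factor])
  then show ?thesis
    by (cases "n = 3") (simp_all add: cubic_mseries_def[abs_def], simp add: multilinear_def linear_zero)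
qed

lemma factorial_bounded_cubic_mseries:
  "factorial_bounded cubic_mseries (6 * (onorm \<xi> + onorm \<theta>) ^ 3 * norm a) 1"
  unfolding factorial_bounded_def
proof (intro allI impI)
  fix n and zs :: "('a \<times> 'a) list" assume zs: "length zs = n"
  let ?B = "onorm \<xi> + onorm \<theta>"
  have B: "0 \<le> ?B"
    using linear_xi linear_theta by (simp add: linear_conv_bounded_linear onorm_pos_le)
  have P: "0 \<le> prod_list (map norm zs)"
    by (rule prod_list_nonneg) auto
  show "norm (cubic_mseries n zs) \<le> 6 * ?B ^ 3 * norm a * 1 ^ n / fact n * prod_list (map norm zs)"
  proof (cases "n = 3")
    case True
    have "norm (cubic_mseries n zs) \<le> ?B ^ 3 * prod_list (map norm zs) * norm a"
      using abs_prod_le_power_prod_list_norm[of 3 cubic_factor ?B zs] abs_cubic_factor_le zs True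
      by (simp add: cubic_mseries_def abs_mult mult_right_mono)
    also have "\<dots> = 6 * ?B ^ 3 * norm a * 1 ^ n / fact n * prod_list (map norm zs)"
      using True by (simp add: numeral_3_eq_3)
    finally show ?thesis .
  qed (use B P in \<open>simp add: cubic_mseries_def\<close>)
qed

lemma entire_cubic_mseries: "entire_mseries cubic_mseries"
proof -
  have "0 \<le> onorm \<xi> + onorm \<theta>"
    using linear_xi linear_theta by (simp add: linear_conv_bounded_linear onorm_pos_le)
  then show ?thesis
    unfolding entire_mseries_def using multilinear_cubic_mseries factorial_bounded_cubic_mseries
    by (intro conjI allI exI[of _ "6 * (onorm \<xi> + onorm \<theta>) ^ 3 * norm a"] exI[of _ 1]) simp_all
qed

lemma smooth_rack: "smooth_map (\<lambda>(x, y). rack x y)"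
proof -
  have "(\<lambda>(x, y). rack x y) = (\<lambda>z. mseries_sum Ad_mseries z + mseries_sum cubic_mseries z)"
    by (auto simp: rack_def mseries_sum_Ad_mseries mseries_sum_cubic_mseries)
  then show ?thesis
    using smooth_map_add[OF smooth_mseries_sum[OF entire_Ad_mseries] smooth_mseries_sum[OF entire_cubic_mseries]]
    by simp
qed

lemma rack_bracket: "rack_bracket_is rack br"
  unfolding rack_bracket_is_def
proof (intro allI)
  fix u v
  have quadratic: "\<xi> (t *\<^sub>R u) * \<xi> (t *\<^sub>R u) * \<theta> v = t * t * (\<xi> u * \<xi> u * \<theta> v)" for t
    by (simp add: linear_scale[OF linear_xi])
  have "((\<lambda>t. (t * t * (\<xi> u * \<xi> u * \<theta> v)) *\<^sub>R a) has_vector_derivative 0) (at 0)"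
    by (auto intro!: derivative_eq_intros)
  from has_vector_derivative_add[OF Ad_has_vector_derivative this]
  show "((\<lambda>t. rack (t *\<^sub>R u) v) has_vector_derivative br u v) (at 0)"
    by (simp add: rack_def quadratic)
qed

lemma linear_rack: "linear (rack x)"
  unfolding rack_def[abs_def]
  by (rule linearI) (simp_all add: linear_add[OF linear_Ad] linear_scale[OF linear_Ad]
      linear_add[OF linear_theta] linear_scale[OF linear_theta] algebra_simps scaleR_add_left)

text \<open>Applying \<open>\<theta>\<close>, which is invariant under \<open>e\<^sup>a\<^sup>d \<^sup>x\<close>, to \<open>rack x y = 0\<close> gives
  \<open>\<theta>(y) (1 + \<xi>(x)\<^sup>2 \<theta>(a)) = 0\<close>; this is where \<open>\<theta> a \<ge> 0\<close> is needed.\<close>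
lemma inj_rack: "inj (rack x)"
proof -
  have "y = 0" if y: "rack x y = 0" for y
  proof -
    have "\<theta> (rack x y) = \<theta> y * (1 + \<xi> x * \<xi> x * \<theta> a)"
      by (simp add: rack_def linear_add[OF linear_theta] linear_scale[OF linear_theta]
          functional_Ad[OF linear_theta theta_br] algebra_simps)
    moreover have "0 < 1 + \<xi> x * \<xi> x * \<theta> a"
      using theta_a by (simp add: add_pos_nonneg)
    ultimately have "\<theta> y = 0"
      using y by (simp add: linear_0[OF linear_theta])
    then have "Ad x y = 0"
      using y by (simp add: rack_def)
    then show "y = 0"
      using Ad_neg_Ad[of x y] by (simp add: linear_0[OF linear_Ad])
  qed
  then show ?thesis
    by (simp add: linear_injective_0[OF linear_rack])
qed

lemma bij_rack: "bij (rack x)"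
  using inj_rack linear_inj_imp_surj[OF linear_rack inj_rack] by (simp add: bij_def)

lemma rack_self_distrib: "rack x (rack y z) = rack (rack x y) (rack x z)"
proof -
  let ?q = "\<lambda>w. \<xi> w * \<xi> w"
  have Ad_a: "Ad w a = a" for w
    by (simp add: Ad_eq_self br_central_right)
  have theta_Ad: "\<theta> (Ad w q) = \<theta> q" for w q
    by (rule functional_Ad[OF linear_theta theta_br])
  have theta_rack: "\<theta> (rack x z) = \<theta> z + ?q x * \<theta> z * \<theta> a"
    by (simp add: rack_def linear_add[OF linear_theta] linear_scale[OF linear_theta] theta_Ad)
  have xi_rack: "\<xi> (rack x y) = \<xi> y"
    by (simp add: rack_def linear_add[OF linear_xi] linear_scale[OF linear_xi]
        functional_Ad[OF linear_xi xi_br] xi_a)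
  have Ad_rack: "Ad (rack x y) = Ad (Ad x y)"
    unfolding rack_def by (rule Ad_add_left_annihilator) (simp add: br.scaleR_left br_central_left)
  have "rack x (rack y z) = Ad x (Ad y z) + (?q y * \<theta> z) *\<^sub>R a + (?q x * (\<theta> z + ?q y * \<theta> z * \<theta> a)) *\<^sub>R a"
    by (simp add: rack_def linear_add[OF linear_Ad] linear_scale[OF linear_Ad] Ad_a
        linear_add[OF linear_theta] linear_scale[OF linear_theta] theta_Ad)
  moreover have "rack (rack x y) (rack x z)
      = Ad x (Ad y z) + (?q x * \<theta> z) *\<^sub>R a + (?q y * (\<theta> z + ?q x * \<theta> z * \<theta> a)) *\<^sub>R a"
    unfolding rack_def[of "rack x y"] xi_rack Ad_rack theta_rack
    by (simp add: rack_def linear_add[OF linear_Ad] linear_scale[OF linear_Ad] Ad_a Ad_Ad)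
  ultimately show ?thesis
    by (simp add: algebra_simps)
qed

lemma rack_zero_right: "rack x 0 = 0"
  by (rule linear_0[OF linear_rack])

lemma rack_zero_left: "rack 0 = id"
  by (simp add: fun_eq_iff rack_def linear_0[OF linear_xi])

lemma linear_lie_rack_rack: "linear_lie_rack rack"
  unfolding linear_lie_rack_def
  by (intro conjI allI smooth_rack linear_rack bij_rack rack_self_distrib rack_zero_right rack_zero_left)

definition rack_coeff :: "nat \<Rightarrow> 'a list \<Rightarrow> 'a \<Rightarrow> 'a" where
  "rack_coeff n xs y = sym_ad_coeff n xs y + (if n = 2 then ((\<Prod>i<n. \<xi> (xs ! i)) * \<theta> y) *\<^sub>R a else 0)"

lemma linear_rack_coeff: "linear (rack_coeff n xs)"
proof -
  have "linear (\<lambda>y. \<theta> y *\<^sub>R a)"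
    using linear_compose[OF linear_theta linear_scaleR_left] by (simp add: o_def)
  then have "linear (\<lambda>y. (c * \<theta> y) *\<^sub>R a)" for c
    using linear_compose_scale_right[of "\<lambda>y. \<theta> y *\<^sub>R a" c] by simp
  then show ?thesis
    unfolding rack_coeff_def[abs_def]
    by (intro linear_compose_add linear_sym_ad_coeff) (cases "n = 2", simp_all add: linear_zero)
qed

lemma multilinear_rack_coeff: "multilinear n (\<lambda>xs. rack_coeff n xs y)"
  unfolding multilinear_def
proof (intro allI impI)
  fix xs :: "'a list" and i assume xs: "length xs = n \<and> i < n"
  have "multilinear n (\<lambda>xs. (\<Prod>j<n. \<xi> (xs ! j)) *\<^sub>R (\<theta> y *\<^sub>R a))"
    by (rule multilinear_scaleR_prod) (rule linear_xi)
  from multilinearD[OF this] multilinearD[OF multilinear_sym_ad_coeff]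
  have "linear (\<lambda>v. (\<Prod>j<n. \<xi> (xs[i := v] ! j)) *\<^sub>R (\<theta> y *\<^sub>R a))"
    and sym: "linear (\<lambda>v. sym_ad_coeff n (xs[i := v]) y)"
    using xs by auto
  then have "linear (\<lambda>v. sym_ad_coeff n (xs[i := v]) y
      + (if n = 2 then ((\<Prod>j<n. \<xi> (xs[i := v] ! j)) * \<theta> y) *\<^sub>R a else 0))"
    by (cases "n = 2") (simp_all add: linear_compose_add)
  then show "linear (\<lambda>v. rack_coeff n (xs[i := v]) y)"
    by (simp add: rack_coeff_def)
qed

lemma symmetric_rack_coeff: "symmetric_args n (\<lambda>xs. rack_coeff n xs y)"
  unfolding symmetric_args_def
proof (intro allI impI)
  fix xs ys :: "'a list" assume "length xs = n \<and> mset xs = mset ys"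
  then have xs: "length xs = n" and ys: "length ys = n" and m: "mset xs = mset ys"
    using mset_eq_length[of xs ys] by auto
  have prod_xi: "(\<Prod>i<length zs. \<xi> (zs ! i)) = prod_list (map \<xi> zs)" for zs
    by (simp add: prod.list_conv_set_nth atLeast0LessThan)
  have "prod_list (map \<xi> xs) = prod_list (map \<xi> ys)"
    by (metis m mset_map prod_mset_prod_list)
  then have "(\<Prod>i<n. \<xi> (xs ! i)) = (\<Prod>i<n. \<xi> (ys ! i))"
    using prod_xi[of xs] prod_xi[of ys] xs ys by simp
  moreover have "sym_ad_coeff n xs y = sym_ad_coeff n ys y"
    using symmetric_sym_ad_coeff[of n y] xs m by (simp add: symmetric_args_def)
  ultimately show "rack_coeff n xs y = rack_coeff n ys y"
    by (cases "n = 2") (simp_all add: rack_coeff_def)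
qed

lemma sums_rack_coeff: "(\<lambda>n. rack_coeff (Suc n) (replicate (Suc n) x) y) sums (rack x y - y)"
proof -
  have "(\<lambda>n. (1 / fact (Suc n)) *\<^sub>R (br x ^^ Suc n) y) sums (Ad x y - y)"
    using sums_Suc_iff[of "\<lambda>k. (1 / fact k) *\<^sub>R (br x ^^ k) y"] sums_Ad[of x y] by simp
  then have "(\<lambda>n. (1 / fact (Suc n)) *\<^sub>R (br x ^^ Suc n) y + (if n = 1 then (\<xi> x * \<xi> x * \<theta> y) *\<^sub>R a else 0))
      sums (Ad x y - y + (\<xi> x * \<xi> x * \<theta> y) *\<^sub>R a)"
    by (rule sums_add) (rule sums_single)
  moreover have "rack_coeff (Suc n) (replicate (Suc n) x) y
      = (1 / fact (Suc n)) *\<^sub>R (br x ^^ Suc n) y + (if n = 1 then (\<xi> x * \<xi> x * \<theta> y) *\<^sub>R a else 0)" for n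
    by (cases "n = 1")
      (simp_all add: rack_coeff_def sym_ad_coeff_replicate numeral_2_eq_2 lessThan_Suc del: replicate_Suc)
  ultimately show ?thesis
    by (simp add: rack_def algebra_simps)
qed

lemma analytic_rack_rack: "analytic_rack rack"
  unfolding analytic_rack_def
  by (intro conjI exI[of _ rack_coeff] allI impI linear_lie_rack_rack linear_rack_coeff
      multilinear_rack_coeff symmetric_rack_coeff sums_rack_coeff)

lemma not_rigid:
  assumes "\<xi> x\<^sub>0 = 1" "br x\<^sub>0 w = 0" "\<theta> w \<noteq> 0" "a \<noteq> 0"
  shows "\<not> rigid br"
proof
  assume "rigid br"
  then have "\<exists>F p P. real_analytic_fun F \<and> F 0 = 1 \<and> invariant_form br p P \<and>
      (\<forall>x y. rack x y = exp_ad br (F (P (replicate p x))) x y)"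
    using analytic_rack_rack rack_bracket unfolding rigid_def by simp
  then obtain F p P where "real_analytic_fun F \<and> F 0 = 1 \<and> invariant_form br p P \<and>
      (\<forall>x y. rack x y = exp_ad br (F (P (replicate p x))) x y)"
    by blast
  then have "rack x\<^sub>0 w = w"
    by (simp add: exp_ad_eq_self assms(2))
  moreover have "rack x\<^sub>0 w = w + \<theta> w *\<^sub>R a"
    by (simp add: rack_def Ad_eq_self assms(1,2))
  ultimately show False
    using assms(3,4) by simp
qed

end

section \<open>Non-rigidity\<close>

lemma functional_vanishing_on_span:
  fixes T :: "'a::euclidean_space set"
  assumes "x \<notin> span T"
  obtains f :: "'a \<Rightarrow> real" where "linear f" "\<And>t. t \<in> span T \<Longrightarrow> f t = 0" "f x = 1"
proof -
  obtain y z where yz: "y \<in> span T" "\<And>w. w \<in> span T \<Longrightarrow> orthogonal z w" "x = y + z"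
    using orthogonal_subspace_decomp_exists[of T x] by blast
  have "z \<noteq> 0"
    using assms yz by auto
  define f where "f v = (z \<bullet> v) / (z \<bullet> z)" for v
  have "linear f"
    unfolding f_def[abs_def] by (rule linearI) (simp_all add: inner_add_right add_divide_distrib)
  moreover have "f t = 0" if "t \<in> span T" for t
    using yz(2)[OF that] by (simp add: f_def orthogonal_def)
  moreover have "f x = 1"
    using yz(2)[OF yz(1)] \<open>z \<noteq> 0\<close> by (simp add: f_def yz(3) inner_add_right orthogonal_def)
  ultimately show ?thesis
    by (rule that)
qed

lemma (in leibniz_algebra) functional_vanishing_on_derived_and:
  assumes "c \<in> lcenter br" and "{u + v | u v. u \<in> derived br \<and> v \<in> lcenter br} \<noteq> UNIV"
  obtains \<xi> :: "'a \<Rightarrow> real" and x\<^sub>0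
  where "linear \<xi>" "\<And>u v. \<xi> (br u v) = 0" "\<xi> c = 0" "\<xi> x\<^sub>0 = 1"
proof -
  let ?S = "{br x y | x y. True}"
  have "span (insert c ?S) \<subseteq> {u + v | u v. u \<in> derived br \<and> v \<in> lcenter br}"
  proof
    fix x assume "x \<in> span (insert c ?S)"
    then obtain k where k: "x - k *\<^sub>R c \<in> span ?S"
      by (auto simp: span_insert)
    have "k *\<^sub>R c \<in> lcenter br"
      using assms(1) by (simp add: lcenter_def br.scaleR_left br.scaleR_right)
    with k show "x \<in> {u + v | u v. u \<in> derived br \<and> v \<in> lcenter br}"
      unfolding derived_def by force
  qed
  then obtain x\<^sub>0 where x\<^sub>0: "x\<^sub>0 \<notin> span (insert c ?S)"
    using assms(2) by blast
  obtain \<xi> :: "'a \<Rightarrow> real" where \<xi>: "linear \<xi>" "\<And>t. t \<in> span (insert c ?S) \<Longrightarrow> \<xi> t = 0" "\<xi> x\<^sub>0 = 1"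
    by (rule functional_vanishing_on_span[OF x\<^sub>0]) (rule that)
  show ?thesis
  proof (rule that[OF \<xi>(1) _ _ \<xi>(3)])
    show "\<xi> (br u v) = 0" for u v
      by (rule \<xi>(2)) (auto intro: span_base)
    show "\<xi> c = 0"
      by (rule \<xi>(2)) (auto intro: span_base)
  qed
qed

lemma (in leibniz_algebra) not_rigid_if_lie_with_nonzero_center:
  assumes lie: "is_lie_bracket br"
    and proper: "{u + v | u v. u \<in> derived br \<and> v \<in> lcenter br} \<noteq> UNIV"
    and "lcenter br \<noteq> {0}"
  shows "\<not> rigid br"
proof -
  obtain a where a: "a \<in> lcenter br" "a \<noteq> 0"
    using assms(3) zero_in_lcenter by auto
  obtain \<xi> :: "'a \<Rightarrow> real" and x\<^sub>0
    where \<xi>: "linear \<xi>" "\<And>u v. \<xi> (br u v) = 0" "\<xi> a = 0" "\<xi> x\<^sub>0 = 1"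
    by (rule functional_vanishing_on_derived_and[OF a(1) proper]) (rule that)
  interpret rack_deformation br a \<xi> \<xi>
    by (intro rack_deformation.intro leibniz_algebra_axioms rack_deformation_axioms.intro)
      (use a \<xi> in simp_all)
  have "br x\<^sub>0 x\<^sub>0 = - br x\<^sub>0 x\<^sub>0"
    using lie unfolding is_lie_bracket_def by blast
  then have "(2::real) *\<^sub>R br x\<^sub>0 x\<^sub>0 = 0"
    by (simp add: scaleR_2 eq_neg_iff_add_eq_0)
  with \<xi>(4) a(2) show ?thesis
    by (intro not_rigid[of x\<^sub>0 x\<^sub>0]) simp_all
qed

lemma (in leibniz_algebra) not_rigid_if_center_not_derived:
  assumes proper: "{u + v | u v. u \<in> derived br \<and> v \<in> lcenter br} \<noteq> UNIV"
    and "\<not> lcenter br \<subseteq> derived br"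
  shows "\<not> rigid br"
proof -
  obtain a where a: "a \<in> lcenter br" "a \<notin> span {br x y | x y. True}"
    using assms(2) by (auto simp: derived_def)
  obtain \<xi> :: "'a \<Rightarrow> real" and x\<^sub>0
    where \<xi>: "linear \<xi>" "\<And>u v. \<xi> (br u v) = 0" "\<xi> a = 0" "\<xi> x\<^sub>0 = 1"
    by (rule functional_vanishing_on_derived_and[OF a(1) proper]) (rule that)
  obtain \<theta> :: "'a \<Rightarrow> real"
    where \<theta>: "linear \<theta>" "\<And>t. t \<in> span {br x y | x y. True} \<Longrightarrow> \<theta> t = 0" "\<theta> a = 1"
    by (rule functional_vanishing_on_span[OF a(2)]) (rule that)
  have "\<theta> (br u v) = 0" for u v
    by (intro \<theta>(2) span_base) auto
  then interpret rack_deformation br a \<xi> \<theta>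
    by (intro rack_deformation.intro leibniz_algebra_axioms rack_deformation_axioms.intro)
      (use a \<xi> \<theta> in simp_all)
  have "a \<noteq> 0"
    using a(2) span_zero by auto
  with \<xi>(4) \<theta>(3) show ?thesis
    by (intro not_rigid[of x\<^sub>0 a] br_central_right) simp_all
qed

theorem corollary1:
  fixes br :: "'a::euclidean_space \<Rightarrow> 'a \<Rightarrow> 'a"
  assumes "left_leibniz_algebra br"
  shows "(is_lie_bracket br \<and> {u + v | u v. u \<in> derived br \<and> v \<in> lcenter br} \<noteq> UNIV
            \<and> lcenter br \<noteq> {0} \<longrightarrow> \<not> rigid br)
       \<and> ({u + v | u v. u \<in> derived br \<and> v \<in> lcenter br} \<noteq> UNIV
            \<and> \<not> lcenter br \<subseteq> derived br \<longrightarrow> \<not> rigid br)"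
proof -
  interpret leibniz_algebra br
    by (rule leibniz_algebra.intro) fact
  show ?thesis
    using not_rigid_if_lie_with_nonzero_center not_rigid_if_center_not_derived by blast
qed

end
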